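(* Let $G$ be a polycyclic-by-finite group and let $S=\bigoplus_{g\in G}S_g$ be an epsilon-strongly $G$-graded ring with principal component $R=S_e$. Then $S$ is left noetherian if and only if $R$ is left noetherian, and $S$ is right noetherian if and only if $R$ is right noetherian.
   Context: All rings are associative with multiplicative identity $1\neq 0$. A ring $S$ is $G$-graded if $S=\bigoplus_{g\in G}S_g$ for additive subgroups $S_g$ with $S_gS_h\subseteq S_{gh}$ for all $g,h\in G$; $S_e$ ($e$ the neutral element) is the principal component. $S$ is epsilon-strongly $G$-graded if (a) $S_gS_{g^{-1}}S_g=S_g$ for all $g\in G$, and (b) for each $g\in G$ the ideal $S_gS_{g^{-1}}$ of $S_e$ has a multiplicative identity (is a unital ideal). A group is polycyclic-by-finite if it has a subnormal series $1=G_0\lhd G_1\lhd\cdots\lhd G_n\lhd G_{n+1}=G$ with $G/G_n$ finite and each $G_{i+1}/G_i$ ($0\le i\le n-1$) cyclic. *)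

theory Defs
  imports "HOL-Algebra.Algebra"
begin

definition set_prod :: "('a, 'b) ring_scheme \<Rightarrow> 'a set \<Rightarrow> 'a set \<Rightarrow> 'a set" where
  "set_prod S A B = {x. \<exists>(n::nat) f g. (\<forall>i<n. f i \<in> A \<and> g i \<in> B) \<and>
       x = finsum S (\<lambda>i. f i \<otimes>\<^bsub>S\<^esub> g i) {..<n}}"

definition graded_ring ::
  "('a, 'b) ring_scheme \<Rightarrow> ('g, 'c) monoid_scheme \<Rightarrow> ('g \<Rightarrow> 'a set) \<Rightarrow> bool" where
  "graded_ring S G Sg \<longleftrightarrow>
     ring S \<and> \<one>\<^bsub>S\<^esub> \<noteq> \<zero>\<^bsub>S\<^esub> \<and> group G \<and>
     (\<forall>g\<in>carrier G. additive_subgroup (Sg g) S) \<and>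
     (\<forall>g\<in>carrier G. \<forall>h\<in>carrier G. \<forall>x\<in>Sg g. \<forall>y\<in>Sg h. x \<otimes>\<^bsub>S\<^esub> y \<in> Sg (g \<otimes>\<^bsub>G\<^esub> h)) \<and>
     (\<forall>x\<in>carrier S. \<exists>!f. f \<in> extensional (carrier G) \<and>
          finite {g\<in>carrier G. f g \<noteq> \<zero>\<^bsub>S\<^esub>} \<and>
          (\<forall>g\<in>carrier G. f g \<in> Sg g) \<and>
          x = finsum S f {g\<in>carrier G. f g \<noteq> \<zero>\<^bsub>S\<^esub>})"

definition epsilon_strongly_graded ::
  "('a, 'b) ring_scheme \<Rightarrow> ('g, 'c) monoid_scheme \<Rightarrow> ('g \<Rightarrow> 'a set) \<Rightarrow> bool" where
  "epsilon_strongly_graded S G Sg \<longleftrightarrow>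
     graded_ring S G Sg \<and>
     (\<forall>g\<in>carrier G.
        set_prod S (set_prod S (Sg g) (Sg (inv\<^bsub>G\<^esub> g))) (Sg g) = Sg g \<and>
        (\<exists>\<epsilon>\<in>set_prod S (Sg g) (Sg (inv\<^bsub>G\<^esub> g)).
           \<forall>x\<in>set_prod S (Sg g) (Sg (inv\<^bsub>G\<^esub> g)). \<epsilon> \<otimes>\<^bsub>S\<^esub> x = x \<and> x \<otimes>\<^bsub>S\<^esub> \<epsilon> = x))"

definition left_ideal :: "'a set \<Rightarrow> ('a, 'b) ring_scheme \<Rightarrow> bool" where
  "left_ideal I R \<longleftrightarrow> additive_subgroup I R \<and>
     (\<forall>r\<in>carrier R. \<forall>x\<in>I. r \<otimes>\<^bsub>R\<^esub> x \<in> I)"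

definition right_ideal :: "'a set \<Rightarrow> ('a, 'b) ring_scheme \<Rightarrow> bool" where
  "right_ideal I R \<longleftrightarrow> additive_subgroup I R \<and>
     (\<forall>r\<in>carrier R. \<forall>x\<in>I. x \<otimes>\<^bsub>R\<^esub> r \<in> I)"

definition left_noetherian :: "('a, 'b) ring_scheme \<Rightarrow> bool" where
  "left_noetherian R \<longleftrightarrow> (\<forall>I :: nat \<Rightarrow> 'a set.
     (\<forall>n. left_ideal (I n) R) \<and> (\<forall>n. I n \<subseteq> I (Suc n)) \<longrightarrow> (\<exists>N. \<forall>n\<ge>N. I n = I N))"

definition right_noetherian :: "('a, 'b) ring_scheme \<Rightarrow> bool" where
  "right_noetherian R \<longleftrightarrow> (\<forall>I :: nat \<Rightarrow> 'a set.
     (\<forall>n. right_ideal (I n) R) \<and> (\<forall>n. I n \<subseteq> I (Suc n)) \<longrightarrow> (\<exists>N. \<forall>n\<ge>N. I n = I N))"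

definition polycyclic_by_finite :: "('g, 'c) monoid_scheme \<Rightarrow> bool" where
  "polycyclic_by_finite G \<longleftrightarrow> group G \<and>
     (\<exists>(n::nat) (H :: nat \<Rightarrow> 'g set).
        H 0 = {\<one>\<^bsub>G\<^esub>} \<and> H (Suc n) = carrier G \<and>
        (\<forall>i\<le>Suc n. subgroup (H i) G) \<and>
        (\<forall>i\<le>n. normal (H i) (G\<lparr>carrier := H (Suc i)\<rparr>)) \<and>
        finite (carrier (G Mod H n)) \<and>
        (\<forall>i<n. cyclic_group ((G\<lparr>carrier := H (Suc i)\<rparr>) Mod (H i))))"

end

theory Submission
  imports Defs
begin

text \<open>
  For a subgroup \<open>H\<close>, call a left ideal \<open>H\<close>-homogeneous if it is the sum of its parts supported on
  left cosets \<open>gH\<close>. Being \<open>1\<close>-homogeneous means being graded, and every left ideal is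
  \<open>G\<close>-homogeneous. Since \<open>\<epsilon>\<^sub>g\<close> is a left identity on \<open>S\<^sub>g\<close>, a graded left ideal \<open>I\<close> is generated by
  \<open>I \<inter> R\<close>, so the ascending chain condition (ACC) for \<open>1\<close>-homogeneous left ideals follows from the
  one for \<open>R\<close>. The ACC climbs the subnormal series by a Hilbert basis argument: if \<open>H\<close> is normal in
  \<open>H'\<close> and \<open>H'/H\<close> is generated by \<open>tH\<close>, attach to an \<open>H'\<close>-homogeneous left ideal \<open>I\<close> and
  \<open>j \<ge> 0\<close> the \<open>H\<close>-homogeneous left ideal of all \<open>gH\<close>-parts of elements of \<open>I\<close> supported on
  \<open>gH \<union> gHt \<union> \<dots> \<union> gHt\<^sup>j\<close>. These leading ideals increase with \<open>j\<close> and with \<open>I\<close>, and together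
  they determine \<open>I\<close> among the left ideals containing it. For a finite quotient the same works with
  an enumeration of coset representatives in place of the powers of \<open>t\<close>.

  Conversely, every left ideal of \<open>R\<close> is the contraction of a left ideal of \<open>S\<close>. The right-handed
  statement is the left-handed one for the opposite ring, graded by \<open>g \<mapsto> S\<^bsub>g\<^sup>-\<^sup>1\<^esub>\<close>.
\<close>

section \<open>Ascending chain conditions\<close>

text \<open>The condition is kept free of any ring so that it can be carried from
  \<open>homog H\<close> to \<open>homog H'\<close> along the series.\<close>

definition acc_on :: "('a set \<Rightarrow> bool) \<Rightarrow> bool" where
  "acc_on P \<longleftrightarrow> (\<forall>I :: nat \<Rightarrow> 'a set.
     (\<forall>n. P (I n)) \<and> (\<forall>n. I n \<subseteq> I (Suc n)) \<longrightarrow> (\<exists>N. \<forall>n\<ge>N. I n = I N))"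

lemma acc_onD:
  assumes "acc_on P" "\<And>n. P (I n)" "\<And>n. I n \<subseteq> I (Suc n)"
  obtains N where "\<And>n. N \<le> n \<Longrightarrow> I n = I N"
proof -
  have "(\<forall>n. P (I n)) \<and> (\<forall>n. I n \<subseteq> I (Suc n))"
    using assms(2,3) by blast
  then have "\<exists>N. \<forall>n\<ge>N. I n = I N"
    using assms(1) unfolding acc_on_def by (elim allE impE)
  then show ?thesis using that by blast
qed

lemma acc_on_finite_family:
  assumes acc: "acc_on P" and P: "\<And>j n. P (A j n)"
    and mono: "\<And>j n. A j n \<subseteq> A j (Suc n)"
  shows "\<exists>N. \<forall>n\<ge>N. \<forall>j<(m::nat). A j n = A j N"
proof -
  have "\<exists>N. \<forall>n\<ge>N. A j n = A j N" for j
    by (rule acc_onD[OF acc, of "A j"]) (use P mono in auto)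
  then obtain N where N: "\<And>j n. N j \<le> n \<Longrightarrow> A j n = A j (N j)"
    by metis
  have "N j \<le> Max (N ` {..<m})" if "j < m" for j
    using that by (intro Max_ge) auto
  then show ?thesis
    using N by (metis order.trans)
qed

text \<open>The diagonal stabilises at some M, which fixes every \<open>A j n\<close> with both
  indices at least M. Only the rows below M remain, and these are finitely many chains.\<close>

lemma acc_on_double_chain:
  fixes A :: "nat \<Rightarrow> nat \<Rightarrow> 'a set"
  assumes acc: "acc_on P" and P: "\<And>j n. P (A j n)"
    and mono1: "\<And>j n. A j n \<subseteq> A (Suc j) n" and mono2: "\<And>j n. A j n \<subseteq> A j (Suc n)"
  shows "\<exists>N. \<forall>n\<ge>N. \<forall>j. A j n = A j N"
proof -
  have m1: "A i n \<subseteq> A j n" if "i \<le> j" for i j n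
    using lift_Suc_mono_le[of "\<lambda>j. A j n"] mono1 that by blast
  have m2: "A j k \<subseteq> A j n" if "k \<le> n" for j k n
    using lift_Suc_mono_le[of "A j"] mono2 that by blast
  obtain M where M: "\<And>n. M \<le> n \<Longrightarrow> A n n = A M M"
    by (rule acc_onD[OF acc, of "\<lambda>n. A n n"]) (use P mono1 mono2 in \<open>blast+\<close>)
  have big: "A j n = A M M" if "M \<le> j" "M \<le> n" for j n
  proof
    have "A j n \<subseteq> A (max j n) (max j n)"
      using m1[of j "max j n"] m2[of n "max j n"] by (meson max.cobounded1 max.cobounded2 order.trans)
    then show "A j n \<subseteq> A M M"
      using M[of "max j n"] that by auto
    show "A M M \<subseteq> A j n"
      using m1 m2 that by (meson order.trans)
  qed
  obtain K where K: "\<forall>n\<ge>K. \<forall>j<M. A j n = A j K"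
    using acc_on_finite_family[of P A M] acc P mono2 by blast
  have "A j n = A j (max K M)" if "max K M \<le> n" for j n
  proof (cases "j < M")
    case True
    then show ?thesis
      using K that by (metis max.cobounded1 order.trans)
  next
    case False
    then show ?thesis
      using that big[of j n] big[of j "max K M"] by simp
  qed
  then show ?thesis by blast
qed

lemma left_noetherian_iff_acc_on: "left_noetherian R \<longleftrightarrow> acc_on (\<lambda>I. left_ideal I R)"
  by (simp add: left_noetherian_def acc_on_def)

section \<open>Components of a graded ring\<close>

lemma (in group) inv_cancel_left:
  assumes "x \<in> carrier G" "y \<in> carrier G"
  shows "x \<otimes> (inv x \<otimes> y) = y" "inv x \<otimes> (x \<otimes> y) = y"
  using assms by (simp_all flip: m_assoc)

lemma (in ring) set_prod_induct [consumes 3, case_names zero mult add]: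
  assumes "x \<in> set_prod R A B" "A \<subseteq> carrier R" "B \<subseteq> carrier R"
    and zero: "P \<zero>" and mult: "\<And>a b. a \<in> A \<Longrightarrow> b \<in> B \<Longrightarrow> P (a \<otimes> b)"
    and add: "\<And>x y. \<lbrakk>x \<in> carrier R; y \<in> carrier R; P x; P y\<rbrakk> \<Longrightarrow> P (x \<oplus> y)"
  shows "P x"
proof -
  obtain n :: nat and f g where fg: "\<forall>i<n. f i \<in> A \<and> g i \<in> B"
    and x: "x = finsum R (\<lambda>i. f i \<otimes> g i) {..<n}"
    using assms(1) by (auto simp: set_prod_def)
  \<comment> \<open>Membership in the carrier is proved along with \<open>P\<close>, since the
    hypothesis \<open>add\<close> asks for it.\<close>
  have "finsum R (\<lambda>i. f i \<otimes> g i) {..<m} \<in> carrier R \<and> P (finsum R (\<lambda>i. f i \<otimes> g i) {..<m})"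
    if "m \<le> n" for m
    using that
  proof (induction m)
    case 0
    then show ?case using zero by simp
  next
    case (Suc m)
    have car: "f i \<otimes> g i \<in> carrier R" if "i < n" for i
      using fg that assms(2,3) by blast
    have "finsum R (\<lambda>i. f i \<otimes> g i) {..<Suc m}
        = f m \<otimes> g m \<oplus> finsum R (\<lambda>i. f i \<otimes> g i) {..<m}"
      unfolding lessThan_Suc using Suc.prems car by (intro finsum_insert) auto
    then show ?case
      using Suc.IH Suc.prems car[of m] add[OF _ _ mult[of "f m" "g m"]] fg by (simp add: Suc_le_eq)
  qed
  then show ?thesis using x by blast
qed

text \<open>Component maps replace sums over supports by equations checked degree by degree. Stating
  them as axioms lets the opposite ring, with inverted degrees, be a second instance.\<close>

locale graded_components = ring S + G: group G
  for S :: "('a, 'b) ring_scheme" (structure) and G :: "('g, 'c) monoid_scheme"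
    and Sg :: "'g \<Rightarrow> 'a set" and cmp :: "'a \<Rightarrow> 'g \<Rightarrow> 'a" +
  assumes Sg_subgroup: "g \<in> carrier G \<Longrightarrow> additive_subgroup (Sg g) S"
    and Sg_mult: "\<lbrakk>g \<in> carrier G; h \<in> carrier G; x \<in> Sg g; y \<in> Sg h\<rbrakk>
                    \<Longrightarrow> x \<otimes> y \<in> Sg (g \<otimes>\<^bsub>G\<^esub> h)"
    and cmp_in: "\<lbrakk>x \<in> carrier S; g \<in> carrier G\<rbrakk> \<Longrightarrow> cmp x g \<in> Sg g"
    and cmp_add: "\<lbrakk>x \<in> carrier S; y \<in> carrier S; g \<in> carrier G\<rbrakk>
                    \<Longrightarrow> cmp (x \<oplus> y) g = cmp x g \<oplus> cmp y g"
    and cmp_homogeneous: "\<lbrakk>g \<in> carrier G; h \<in> carrier G; x \<in> Sg g\<rbrakk>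
                    \<Longrightarrow> cmp x h = (if h = g then x else \<zero>)"
    and finite_support: "x \<in> carrier S \<Longrightarrow> finite {g \<in> carrier G. cmp x g \<noteq> \<zero>}"
    and cmp_eqI: "\<lbrakk>x \<in> carrier S; y \<in> carrier S; \<And>g. g \<in> carrier G \<Longrightarrow> cmp x g = cmp y g\<rbrakk>
                    \<Longrightarrow> x = y"
begin

lemma Sg_carrier [simp]: "g \<in> carrier G \<Longrightarrow> x \<in> Sg g \<Longrightarrow> x \<in> carrier S"
  using Sg_subgroup additive_subgroup.a_Hcarr by fast

lemma zero_in_Sg [simp]: "g \<in> carrier G \<Longrightarrow> \<zero> \<in> Sg g"
  using Sg_subgroup additive_subgroup.zero_closed by fast

lemma cmp_closed [simp]: "x \<in> carrier S \<Longrightarrow> g \<in> carrier G \<Longrightarrow> cmp x g \<in> carrier S"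
  using cmp_in Sg_carrier by blast

lemma cmp_zero [simp]: "g \<in> carrier G \<Longrightarrow> cmp \<zero> g = \<zero>"
  using cmp_homogeneous[of g g "\<zero>"] by simp

lemma cmp_minus:
  assumes "x \<in> carrier S" "g \<in> carrier G"
  shows "cmp (\<ominus> x) g = \<ominus> cmp x g"
proof -
  have "cmp (\<ominus> x) g \<oplus> cmp x g = \<zero>"
    using assms cmp_add[of "\<ominus> x" x g] by (simp add: l_neg)
  then show ?thesis
    using assms by (simp add: minus_equality)
qed

lemma cmp_diff:
  assumes "x \<in> carrier S" "y \<in> carrier S" "g \<in> carrier G"
  shows "cmp (x \<ominus> y) g = cmp x g \<ominus> cmp y g"
  using assms by (simp add: a_minus_def cmp_add cmp_minus)

text \<open>Subtracting one nonzero component strictly shrinks the finite support.\<close>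

lemma homogeneous_induct [consumes 1, case_names zero homogeneous add]:
  assumes "x \<in> carrier S" and zero: "P \<zero>"
    and hom: "\<And>g s. \<lbrakk>g \<in> carrier G; s \<in> Sg g\<rbrakk> \<Longrightarrow> P s"
    and add: "\<And>x y. \<lbrakk>x \<in> carrier S; y \<in> carrier S; P x; P y\<rbrakk> \<Longrightarrow> P (x \<oplus> y)"
  shows "P x"
  using assms(1)
proof (induction "card {g \<in> carrier G. cmp x g \<noteq> \<zero>}" arbitrary: x rule: less_induct)
  case less
  show ?case
  proof (cases "{g \<in> carrier G. cmp x g \<noteq> \<zero>} = {}")
    case True
    then have "x = \<zero>"
      using less.prems by (auto intro: cmp_eqI[of x "\<zero>"])
    then show ?thesis using zero by simp
  next
    case False
    then obtain g where g: "g \<in> carrier G" "cmp x g \<noteq> \<zero>" by blast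
    define y where "y = x \<ominus> cmp x g"
    have y: "y \<in> carrier S"
      using less.prems g by (simp add: y_def)
    have cmp_y: "cmp y h = (if h = g then \<zero> else cmp x h)" if "h \<in> carrier G" for h
      using less.prems g that
      by (simp add: y_def cmp_add cmp_minus cmp_homogeneous[of g h "cmp x g"] cmp_in a_minus_def r_neg)
    have "{h \<in> carrier G. cmp y h \<noteq> \<zero>} \<subset> {h \<in> carrier G. cmp x h \<noteq> \<zero>}"
    proof (rule psubsetI)
      show "{h \<in> carrier G. cmp y h \<noteq> \<zero>} \<subseteq> {h \<in> carrier G. cmp x h \<noteq> \<zero>}"
        by (auto simp: cmp_y split: if_splits)
      show "{h \<in> carrier G. cmp y h \<noteq> \<zero>} \<noteq> {h \<in> carrier G. cmp x h \<noteq> \<zero>}"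
        using g cmp_y[of g] by (metis (mono_tags, lifting) mem_Collect_eq)
    qed
    then have "P y"
      by (intro less.hyps y psubset_card_mono finite_support less.prems)
    moreover have "x = y \<oplus> cmp x g"
      using less.prems g by (simp add: y_def a_minus_def a_assoc l_neg)
    moreover have "P (cmp x g)"
      using hom g less.prems cmp_in by blast
    ultimately show ?thesis
      using add[of y "cmp x g"] y g less.prems by simp
  qed
qed

text \<open>By additivity \<open>x\<close> may be taken homogeneous of some degree h. Then the
  product has degree kh, and kg = kh exactly when g = h.\<close>

lemma cmp_mult_left:
  assumes "x \<in> carrier S" "k \<in> carrier G" "g \<in> carrier G" "s \<in> Sg k"
  shows "cmp (s \<otimes> x) (k \<otimes>\<^bsub>G\<^esub> g) = s \<otimes> cmp x g"
  using assms(1)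
proof (induction x rule: homogeneous_induct)
  case zero
  then show ?case using assms by simp
next
  case (homogeneous h t)
  have "s \<otimes> t \<in> Sg (k \<otimes>\<^bsub>G\<^esub> h)"
    using assms homogeneous Sg_mult by blast
  then show ?case
    using assms homogeneous by (auto simp: cmp_homogeneous[of "k \<otimes>\<^bsub>G\<^esub> h"] cmp_homogeneous[of h])
next
  case (add x y)
  then show ?case
    using assms by (simp add: cmp_add r_distr)
qed

lemma cmp_mult_homogeneous:
  assumes "x \<in> carrier S" "k \<in> carrier G" "g \<in> carrier G" "s \<in> Sg k"
  shows "cmp (s \<otimes> x) g = s \<otimes> cmp x (inv\<^bsub>G\<^esub> k \<otimes>\<^bsub>G\<^esub> g)"
proof -
  have "k \<otimes>\<^bsub>G\<^esub> (inv\<^bsub>G\<^esub> k \<otimes>\<^bsub>G\<^esub> g) = g"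
    using assms by (simp add: G.inv_cancel_left)
  then show ?thesis
    using cmp_mult_left[of x k "inv\<^bsub>G\<^esub> k \<otimes>\<^bsub>G\<^esub> g" s] assms by simp
qed

lemma one_in_Sg_one: "\<one> \<in> Sg \<one>\<^bsub>G\<^esub>"
proof -
  let ?u = "cmp \<one> \<one>\<^bsub>G\<^esub>"
  \<comment> \<open>For \<open>x\<close> of degree g, compare the components of degree g in x = x1;
    then put x = 1.\<close>
  have "x \<otimes> ?u = x" if "x \<in> carrier S" for x
    using that
  proof (induction x rule: homogeneous_induct)
    case zero
    then show ?case by simp
  next
    case (homogeneous g s)
    then show ?case
      using cmp_mult_left[of "\<one>" g "\<one>\<^bsub>G\<^esub>" s] by (simp add: cmp_homogeneous[of g])
  next
    case (add x y)
    then show ?case by (simp add: l_distr)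
  qed
  from this[of "\<one>"] have "?u = \<one>" by simp
  then show ?thesis
    using cmp_in[of "\<one>" "\<one>\<^bsub>G\<^esub>"] by simp
qed

lemma ex_restriction:
  assumes "x \<in> carrier S"
  shows "\<exists>y\<in>carrier S. \<forall>h\<in>carrier G. cmp y h = (if h \<in> A then cmp x h else \<zero>)"
  using assms
proof (induction x rule: homogeneous_induct)
  case zero
  show ?case by (intro bexI[of _ "\<zero>"]) auto
next
  case (homogeneous g s)
  then show ?case
    by (intro bexI[of _ "if g \<in> A then s else \<zero>"]) (auto simp: cmp_homogeneous[of g])
next
  case (add x y)
  then obtain x' y' where "x' \<in> carrier S" "y' \<in> carrier S"
    "\<forall>h\<in>carrier G. cmp x' h = (if h \<in> A then cmp x h else \<zero>)"
    "\<forall>h\<in>carrier G. cmp y' h = (if h \<in> A then cmp y h else \<zero>)"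
    by blast
  with add.hyps show ?case
    by (intro bexI[of _ "x' \<oplus> y'"]) (auto simp: cmp_add)
qed

text \<open>For \<open>x\<close> in the carrier the choice is unique by
  \<open>cmp_eqI\<close>.\<close>

definition restr :: "'g set \<Rightarrow> 'a \<Rightarrow> 'a" where
  "restr A x = (SOME y. y \<in> carrier S \<and> (\<forall>h\<in>carrier G. cmp y h = (if h \<in> A then cmp x h else \<zero>)))"

lemma restr_spec:
  assumes "x \<in> carrier S"
  shows restr_closed [simp]: "restr A x \<in> carrier S"
    and cmp_restr [simp]: "h \<in> carrier G \<Longrightarrow> cmp (restr A x) h = (if h \<in> A then cmp x h else \<zero>)"
proof -
  have "restr A x \<in> carrier S \<and>
      (\<forall>h\<in>carrier G. cmp (restr A x) h = (if h \<in> A then cmp x h else \<zero>))"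
    unfolding restr_def by (rule someI_ex) (use ex_restriction[OF assms] in blast)
  then show "restr A x \<in> carrier S"
    and "h \<in> carrier G \<Longrightarrow> cmp (restr A x) h = (if h \<in> A then cmp x h else \<zero>)" by auto
qed

text \<open>Every ring element is a sum of homogeneous ones, so absorption need only be tested on
  these. For leading ideals this matters: a homogeneous factor merely translates supports.\<close>

lemma left_ideal_iff:
  "left_ideal I S \<longleftrightarrow> I \<subseteq> carrier S \<and> \<zero> \<in> I \<and> (\<forall>x\<in>I. \<forall>y\<in>I. x \<ominus> y \<in> I) \<and>
     (\<forall>g\<in>carrier G. \<forall>s\<in>Sg g. \<forall>x\<in>I. s \<otimes> x \<in> I)" (is "?L \<longleftrightarrow> ?R")
proof
  assume ?L
  then interpret additive_subgroup I S by (simp add: left_ideal_def)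
  show ?R
    using \<open>?L\<close> a_subset by (auto simp: left_ideal_def a_minus_def)
next
  assume ?R
  then have sub: "x \<in> I \<Longrightarrow> x \<in> carrier S" and zero: "\<zero> \<in> I"
    and diff: "x \<in> I \<Longrightarrow> y \<in> I \<Longrightarrow> x \<ominus> y \<in> I"
    and mult: "g \<in> carrier G \<Longrightarrow> s \<in> Sg g \<Longrightarrow> x \<in> I \<Longrightarrow> s \<otimes> x \<in> I" for x y g s
    by auto
  have neg: "\<ominus> x \<in> I" if "x \<in> I" for x
    using diff[OF zero that] sub[OF that] by (simp add: a_minus_def)
  have plus: "x \<oplus> y \<in> I" if "x \<in> I" "y \<in> I" for x y
    using diff[OF that(1) neg[OF that(2)]] sub that by (simp add: a_minus_def)
  have "subgroup I (add_monoid S)"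
  proof (rule add.subgroupI)
    show "I \<subseteq> carrier S" using sub by blast
    show "I \<noteq> {}" using zero by blast
    show "\<And>a. a \<in> I \<Longrightarrow> \<ominus> a \<in> I" by (rule neg)
    show "\<And>a b. a \<in> I \<Longrightarrow> b \<in> I \<Longrightarrow> a \<oplus> b \<in> I" by (rule plus)
  qed
  moreover have "r \<otimes> x \<in> I" if "r \<in> carrier S" "x \<in> I" for r x
    using that(1)
  proof (induction r rule: homogeneous_induct)
    case zero
    then show ?case using sub that \<open>\<zero> \<in> I\<close> by simp
  next
    case (homogeneous g s)
    then show ?case using mult that by blast
  next
    case (add a b)
    then show ?case using plus sub that by (simp add: l_distr)
  qed
  ultimately show ?L
    by (simp add: left_ideal_def additive_subgroup_def)
qed

lemma left_ideal_simps:
  assumes "left_ideal I S"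
  shows "I \<subseteq> carrier S" "\<zero> \<in> I" "\<And>x y. x \<in> I \<Longrightarrow> y \<in> I \<Longrightarrow> x \<ominus> y \<in> I"
    "\<And>x y. x \<in> I \<Longrightarrow> y \<in> I \<Longrightarrow> x \<oplus> y \<in> I" "\<And>r x. r \<in> carrier S \<Longrightarrow> x \<in> I \<Longrightarrow> r \<otimes> x \<in> I"
proof -
  interpret additive_subgroup I S using assms by (simp add: left_ideal_def)
  show "I \<subseteq> carrier S" "\<zero> \<in> I" "\<And>x y. x \<in> I \<Longrightarrow> y \<in> I \<Longrightarrow> x \<ominus> y \<in> I"
    "\<And>x y. x \<in> I \<Longrightarrow> y \<in> I \<Longrightarrow> x \<oplus> y \<in> I" "\<And>r x. r \<in> carrier S \<Longrightarrow> x \<in> I \<Longrightarrow> r \<otimes> x \<in> I"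
    using assms a_subset by (auto simp: left_ideal_def a_minus_def)
qed

section \<open>Leading ideals\<close>

text \<open>For a subgroup \<open>H\<close> this is the left coset gH. Left cosets are the right
  choice for left ideals, since a left factor of degree k sends support in gH to support in
  kgH.\<close>

definition shift :: "'g \<Rightarrow> 'g set \<Rightarrow> 'g set" where
  "shift g U = {h \<in> carrier G. inv\<^bsub>G\<^esub> g \<otimes>\<^bsub>G\<^esub> h \<in> U}"

definition homog :: "'g set \<Rightarrow> 'a set \<Rightarrow> bool" where
  "homog H I \<longleftrightarrow> left_ideal I S \<and> (\<forall>x\<in>I. \<forall>g\<in>carrier G. restr (shift g H) x \<in> I)"

text \<open>The witness \<open>x\<close> may vary with \<open>g\<close>, and \<open>z\<close> is not
  confined to one coset. Imposing the condition at each coset separately makes the set additive and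
  \<open>H\<close>-homogeneous without a closure under sums.\<close>

definition lead :: "'g set \<Rightarrow> 'g set \<Rightarrow> 'a set \<Rightarrow> 'a set" where
  "lead H U I = {z \<in> carrier S. \<forall>g\<in>carrier G. \<exists>x\<in>I.
     (\<forall>h\<in>carrier G. h \<notin> shift g U \<longrightarrow> cmp x h = \<zero>) \<and> (\<forall>h\<in>shift g H. cmp x h = cmp z h)}"

lemma shift_carrier: "h \<in> shift g U \<Longrightarrow> h \<in> carrier G"
  by (simp add: shift_def)

lemma shift_translate:
  assumes "g \<in> carrier G" "k \<in> carrier G" "h \<in> carrier G"
  shows "inv\<^bsub>G\<^esub> k \<otimes>\<^bsub>G\<^esub> h \<in> shift (inv\<^bsub>G\<^esub> k \<otimes>\<^bsub>G\<^esub> g) U \<longleftrightarrow> h \<in> shift g U"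
  using assms by (simp add: shift_def G.inv_mult_group G.m_assoc G.inv_cancel_left)

lemma shift_subset:
  assumes H: "subgroup H G" and g: "g \<in> carrier G" "g' \<in> carrier G"
    and gg': "inv\<^bsub>G\<^esub> g' \<otimes>\<^bsub>G\<^esub> g \<in> H"
    and U: "\<And>h u. h \<in> H \<Longrightarrow> u \<in> U \<Longrightarrow> h \<otimes>\<^bsub>G\<^esub> u \<in> U"
  shows "shift g U \<subseteq> shift g' U"
proof
  fix h assume h: "h \<in> shift g U"
  then have "(inv\<^bsub>G\<^esub> g' \<otimes>\<^bsub>G\<^esub> g) \<otimes>\<^bsub>G\<^esub> (inv\<^bsub>G\<^esub> g \<otimes>\<^bsub>G\<^esub> h) \<in> U"
    using U gg' by (simp add: shift_def)
  then show "h \<in> shift g' U"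
    using h g by (simp add: shift_def G.m_assoc G.inv_cancel_left)
qed

lemma inv_mult_in_subgroup:
  assumes H: "subgroup H G" and g: "g \<in> carrier G" "g' \<in> carrier G"
    and gg': "inv\<^bsub>G\<^esub> g \<otimes>\<^bsub>G\<^esub> g' \<in> H"
  shows "inv\<^bsub>G\<^esub> g' \<otimes>\<^bsub>G\<^esub> g \<in> H"
  using subgroup.m_inv_closed[OF H gg'] g by (simp add: G.inv_mult_group)

text \<open>If HU lies in U, the translate gU depends only on the coset gH.\<close>

lemma shift_eq:
  assumes H: "subgroup H G" and g: "g \<in> carrier G" "g' \<in> carrier G"
    and gg': "inv\<^bsub>G\<^esub> g \<otimes>\<^bsub>G\<^esub> g' \<in> H"
    and U: "\<And>h u. h \<in> H \<Longrightarrow> u \<in> U \<Longrightarrow> h \<otimes>\<^bsub>G\<^esub> u \<in> U"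
  shows "shift g U = shift g' U"
  using shift_subset[OF H g(2,1) gg' U] shift_subset[OF H g inv_mult_in_subgroup[OF H g gg'] U]
  by blast

lemma shift_subgroup_eq:
  assumes H: "subgroup H G" and g: "g \<in> carrier G" "g' \<in> carrier G"
    and gg': "inv\<^bsub>G\<^esub> g \<otimes>\<^bsub>G\<^esub> g' \<in> H"
  shows "shift g H = shift g' H"
  using shift_eq[OF H g gg'] subgroup.m_closed[OF H] by blast

lemma shift_meet:
  assumes H: "subgroup H G" and g: "g \<in> carrier G" "g' \<in> carrier G"
    and h: "h \<in> shift g H" "h \<in> shift g' H"
  shows "inv\<^bsub>G\<^esub> g \<otimes>\<^bsub>G\<^esub> g' \<in> H"
proof -
  have hc: "h \<in> carrier G" using h by (simp add: shift_def)
  have "inv\<^bsub>G\<^esub> h \<otimes>\<^bsub>G\<^esub> g' \<in> H"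
    using inv_mult_in_subgroup[OF H g(2) hc] h(2) by (simp add: shift_def)
  then have "(inv\<^bsub>G\<^esub> g \<otimes>\<^bsub>G\<^esub> h) \<otimes>\<^bsub>G\<^esub> (inv\<^bsub>G\<^esub> h \<otimes>\<^bsub>G\<^esub> g') \<in> H"
    using h subgroup.m_closed[OF H] by (simp add: shift_def)
  then show ?thesis
    using hc g by (simp add: G.m_assoc G.inv_cancel_left)
qed

lemma self_in_shift: "subgroup H G \<Longrightarrow> g \<in> carrier G \<Longrightarrow> g \<in> shift g H"
  by (simp add: shift_def subgroup.one_closed)

lemma leadI:
  assumes "z \<in> carrier S"
    and "\<And>g. g \<in> carrier G \<Longrightarrow> \<exists>x\<in>I. (\<forall>h\<in>carrier G. h \<notin> shift g U \<longrightarrow> cmp x h = \<zero>) \<and>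
           (\<forall>h\<in>shift g H. cmp x h = cmp z h)"
  shows "z \<in> lead H U I"
  using assms by (simp add: lead_def)

lemma leadE:
  assumes "z \<in> lead H U I" "g \<in> carrier G"
  obtains x where "x \<in> I" "\<And>h. h \<in> carrier G \<Longrightarrow> h \<notin> shift g U \<Longrightarrow> cmp x h = \<zero>"
    "\<And>h. h \<in> shift g H \<Longrightarrow> cmp x h = cmp z h"
  using assms unfolding lead_def by blast

lemma lead_carrier: "z \<in> lead H U I \<Longrightarrow> z \<in> carrier S"
  by (simp add: lead_def)

lemma lead_mono: "U \<subseteq> U' \<Longrightarrow> I \<subseteq> J \<Longrightarrow> lead H U I \<subseteq> lead H U' J"
  unfolding lead_def shift_def by blast

lemma homog_lead:
  assumes H: "subgroup H G" and I: "left_ideal I S"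
  shows "homog H (lead H U I)"
proof -
  note I' = left_ideal_simps[OF I]
  have diff: "z \<ominus> z' \<in> lead H U I" if z: "z \<in> lead H U I" "z' \<in> lead H U I" for z z'
  proof (rule leadI)
    have zc: "z \<in> carrier S" "z' \<in> carrier S" using z by (auto dest: lead_carrier)
    then show "z \<ominus> z' \<in> carrier S" by simp
    fix g assume g: "g \<in> carrier G"
    obtain x where x: "x \<in> I" "\<And>h. h \<in> carrier G \<Longrightarrow> h \<notin> shift g U \<Longrightarrow> cmp x h = \<zero>"
      "\<And>h. h \<in> shift g H \<Longrightarrow> cmp x h = cmp z h"
      by (rule leadE[OF z(1) g]) blast
    obtain x' where x': "x' \<in> I" "\<And>h. h \<in> carrier G \<Longrightarrow> h \<notin> shift g U \<Longrightarrow> cmp x' h = \<zero>"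
      "\<And>h. h \<in> shift g H \<Longrightarrow> cmp x' h = cmp z' h"
      by (rule leadE[OF z(2) g]) blast
    have xc: "x \<in> carrier S" "x' \<in> carrier S" using x x' I'(1) by auto
    show "\<exists>x\<in>I. (\<forall>h\<in>carrier G. h \<notin> shift g U \<longrightarrow> cmp x h = \<zero>) \<and>
        (\<forall>h\<in>shift g H. cmp x h = cmp (z \<ominus> z') h)"
      by (rule bexI[OF _ I'(3)[OF x(1) x'(1)]])
        (use x x' xc zc in \<open>simp add: cmp_add cmp_minus shift_carrier minus_eq\<close>)
  qed
  have mult: "s \<otimes> z \<in> lead H U I" if k: "k \<in> carrier G" and s: "s \<in> Sg k" and z: "z \<in> lead H U I"
    for k s z
  proof (rule leadI)
    have zc: "z \<in> carrier S" using z by (rule lead_carrier)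
    then show "s \<otimes> z \<in> carrier S" using s k by simp
    fix g assume g: "g \<in> carrier G"
    \<comment> \<open>Multiplication by \<open>s\<close> moves degrees by \<open>k\<close>, so the
      witness at \<open>g\<close> is \<open>s\<close> times the witness for \<open>z\<close> at this
      translate.\<close>
    let ?g = "inv\<^bsub>G\<^esub> k \<otimes>\<^bsub>G\<^esub> g"
    have "?g \<in> carrier G" using g k by simp
    then obtain x where x: "x \<in> I" "\<And>h. h \<in> carrier G \<Longrightarrow> h \<notin> shift ?g U \<Longrightarrow> cmp x h = \<zero>"
      "\<And>h. h \<in> shift ?g H \<Longrightarrow> cmp x h = cmp z h"
      by (rule leadE[OF z]) blast
    have xc: "x \<in> carrier S" using x I'(1) by auto
    have sc: "s \<in> carrier S" using s k by simp
    show "\<exists>x\<in>I. (\<forall>h\<in>carrier G. h \<notin> shift g U \<longrightarrow> cmp x h = \<zero>) \<and>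
        (\<forall>h\<in>shift g H. cmp x h = cmp (s \<otimes> z) h)"
    proof (intro bexI[OF _ I'(5)[OF sc x(1)]] conjI ballI impI)
      fix h assume h: "h \<in> carrier G" "h \<notin> shift g U"
      then show "cmp (s \<otimes> x) h = \<zero>"
        using x(2)[of "inv\<^bsub>G\<^esub> k \<otimes>\<^bsub>G\<^esub> h"] k g s xc sc
        by (simp add: cmp_mult_homogeneous shift_translate)
    next
      fix h assume h: "h \<in> shift g H"
      then have hc: "h \<in> carrier G" by (rule shift_carrier)
      show "cmp (s \<otimes> x) h = cmp (s \<otimes> z) h"
        using x(3)[of "inv\<^bsub>G\<^esub> k \<otimes>\<^bsub>G\<^esub> h"] k g s xc zc hc h
        by (simp add: cmp_mult_homogeneous shift_translate)
    qed
  qed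
  have "\<zero> \<in> lead H U I"
    by (rule leadI) (use I'(2) in \<open>auto intro!: bexI[of _ "\<zero>"] simp: shift_carrier\<close>)
  then have ideal: "left_ideal (lead H U I) S"
    unfolding left_ideal_iff using diff mult lead_carrier by blast
  have "restr (shift g0 H) z \<in> lead H U I" if z: "z \<in> lead H U I" and g0: "g0 \<in> carrier G" for z g0
  proof (rule leadI)
    have zc: "z \<in> carrier S" using z by (rule lead_carrier)
    then show "restr (shift g0 H) z \<in> carrier S" by simp
    fix g assume g: "g \<in> carrier G"
    show "\<exists>x\<in>I. (\<forall>h\<in>carrier G. h \<notin> shift g U \<longrightarrow> cmp x h = \<zero>) \<and>
        (\<forall>h\<in>shift g H. cmp x h = cmp (restr (shift g0 H) z) h)"
    \<comment> \<open>Either the coset of \<open>g\<close> is the one kept, and the old witness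
      serves, or it is disjoint from it, and zero serves.\<close>
    proof (cases "inv\<^bsub>G\<^esub> g0 \<otimes>\<^bsub>G\<^esub> g \<in> H")
      case True
      obtain x where x: "x \<in> I" "\<And>h. h \<in> carrier G \<Longrightarrow> h \<notin> shift g U \<Longrightarrow> cmp x h = \<zero>"
        "\<And>h. h \<in> shift g H \<Longrightarrow> cmp x h = cmp z h"
        by (rule leadE[OF z g]) blast
      have "shift g0 H = shift g H"
        by (rule shift_subgroup_eq[OF H g0 g True])
      then show ?thesis
        by (intro bexI[OF _ x(1)]) (use x zc in \<open>simp add: shift_carrier\<close>)
    next
      case False
      then have "h \<notin> shift g0 H" if "h \<in> shift g H" for h
        using shift_meet[OF H g0 g _ that] by blast
      then show ?thesis
        by (intro bexI[OF _ I'(2)]) (use zc in \<open>simp add: shift_carrier\<close>)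
    qed
  qed
  then show ?thesis using ideal by (simp add: homog_def)
qed

text \<open>At any representative \<open>g'\<close> of the coset gH, \<open>y\<close> itself is a
  witness, because \<open>U\<close> absorbs \<open>H\<close> on the left and hence gU = g'U. At
  every other coset the part is zero.\<close>

lemma restr_in_lead:
  assumes H: "subgroup H G" and I: "left_ideal I S" and y: "y \<in> I" and g: "g \<in> carrier G"
    and supp: "\<And>h. h \<in> carrier G \<Longrightarrow> h \<notin> shift g U \<Longrightarrow> cmp y h = \<zero>"
    and U: "\<And>h u. h \<in> H \<Longrightarrow> u \<in> U \<Longrightarrow> h \<otimes>\<^bsub>G\<^esub> u \<in> U"
  shows "restr (shift g H) y \<in> lead H U I"
proof (rule leadI)
  note I' = left_ideal_simps[OF I]
  have yc: "y \<in> carrier S" using y I' by auto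
  then show "restr (shift g H) y \<in> carrier S" by simp
  fix g' assume g': "g' \<in> carrier G"
  show "\<exists>x\<in>I. (\<forall>h\<in>carrier G. h \<notin> shift g' U \<longrightarrow> cmp x h = \<zero>) \<and>
      (\<forall>h\<in>shift g' H. cmp x h = cmp (restr (shift g H) y) h)"
  proof (cases "inv\<^bsub>G\<^esub> g \<otimes>\<^bsub>G\<^esub> g' \<in> H")
    case True
    have "shift g H = shift g' H" "shift g U = shift g' U"
      by (rule shift_subgroup_eq[OF H g g' True], rule shift_eq[OF H g g' True U])
    then show ?thesis
      by (intro bexI[OF _ y]) (use supp yc in \<open>simp add: shift_carrier\<close>)
  next
    case False
    then have "h \<notin> shift g H" if "h \<in> shift g' H" for h
      using shift_meet[OF H g g' _ that] by blast
    then show ?thesis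
      by (intro bexI[OF _ I'(2)]) (use yc in \<open>simp add: shift_carrier\<close>)
  qed
qed

text \<open>An element is the sum of its finitely many nonzero coset parts; removing one part at a
  time shrinks the support.\<close>

lemma mem_if_restr_mem:
  assumes H: "subgroup H G" and I: "left_ideal I S" and "y \<in> carrier S"
    and "\<And>g. g \<in> carrier G \<Longrightarrow> restr (shift g H) y \<in> I"
  shows "y \<in> I"
  using assms(3,4)
proof (induction "card {g \<in> carrier G. cmp y g \<noteq> \<zero>}" arbitrary: y rule: less_induct)
  case less
  note I' = left_ideal_simps[OF I]
  note y = less.prems(1)
  show ?case
  proof (cases "{g \<in> carrier G. cmp y g \<noteq> \<zero>} = {}")
    case True
    then have "y = \<zero>"
      using y by (auto intro: cmp_eqI[of y "\<zero>"])
    then show ?thesis using I' by simp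
  next
    case False
    then obtain g where g: "g \<in> carrier G" "cmp y g \<noteq> \<zero>" by blast
    define z where "z = y \<ominus> restr (shift g H) y"
    have z: "z \<in> carrier S" using y by (simp add: z_def)
    have cmp_z: "cmp z h = (if h \<in> shift g H then \<zero> else cmp y h)" if "h \<in> carrier G" for h
      using y that by (simp add: z_def cmp_diff) (simp add: minus_eq r_neg)
    have "{h \<in> carrier G. cmp z h \<noteq> \<zero>} \<subset> {h \<in> carrier G. cmp y h \<noteq> \<zero>}"
    proof (rule psubsetI)
      show "{h \<in> carrier G. cmp z h \<noteq> \<zero>} \<subseteq> {h \<in> carrier G. cmp y h \<noteq> \<zero>}"
        by (auto simp: cmp_z split: if_splits)
      have "cmp z g = \<zero>" using cmp_z[of g] g self_in_shift[OF H] by simp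
      then show "{h \<in> carrier G. cmp z h \<noteq> \<zero>} \<noteq> {h \<in> carrier G. cmp y h \<noteq> \<zero>}"
        using g by (metis (mono_tags, lifting) mem_Collect_eq)
    qed
    moreover have "restr (shift g' H) z \<in> I" if g': "g' \<in> carrier G" for g'
    proof (cases "inv\<^bsub>G\<^esub> g \<otimes>\<^bsub>G\<^esub> g' \<in> H")
      case True
      have "shift g H = shift g' H"
        by (rule shift_subgroup_eq[OF H g(1) g' True])
      then have "restr (shift g' H) z = \<zero>"
        by (intro cmp_eqI[OF restr_closed[OF z] zero_closed]) (simp add: z cmp_z)
      then show ?thesis using I' by simp
    next
      case False
      then have "h \<notin> shift g H" if "h \<in> shift g' H" for h
        using shift_meet[OF H g(1) g' _ that] by blast
      then have "restr (shift g' H) z = restr (shift g' H) y"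
        by (intro cmp_eqI[OF restr_closed[OF z] restr_closed[OF y]]) (simp add: z y cmp_z)
      then show ?thesis using less.prems(2)[OF g'] by simp
    qed
    ultimately have "z \<in> I"
      using less.hyps[of z] z psubset_card_mono[OF finite_support[OF y]] by blast
    moreover have "y = z \<oplus> restr (shift g H) y"
      using y by (simp add: z_def a_minus_def a_assoc l_neg)
    ultimately show ?thesis
      using I'(4)[OF _ less.prems(2)[OF g(1)], of z] by simp
  qed
qed

text \<open>The condition says that the cosets \<open>cH\<close> and \<open>Hc\<close> coincide.\<close>

definition normalises :: "'g \<Rightarrow> 'g set \<Rightarrow> bool" where
  "normalises c H \<longleftrightarrow> c \<in> carrier G \<and>
     (\<forall>h\<in>carrier G. inv\<^bsub>G\<^esub> c \<otimes>\<^bsub>G\<^esub> h \<in> H \<longleftrightarrow> h \<otimes>\<^bsub>G\<^esub> inv\<^bsub>G\<^esub> c \<in> H)"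

text \<open>
  \<open>cover H c m\<close> is the union of the cosets \<open>H c\<^sub>l\<close> with \<open>l < m\<close>, and \<open>trail H c j\<close> is
  \<open>cover H c (j + 1)\<close> translated so that its last coset \<open>H c\<^sub>j\<close> becomes \<open>H\<close>. A part in the last
  coset can thus be removed modulo a leading ideal without enlarging the support.
\<close>

definition trail :: "'g set \<Rightarrow> (nat \<Rightarrow> 'g) \<Rightarrow> nat \<Rightarrow> 'g set" where
  "trail H c j = {u \<in> carrier G. \<exists>l\<le>j. c j \<otimes>\<^bsub>G\<^esub> u \<otimes>\<^bsub>G\<^esub> inv\<^bsub>G\<^esub> (c l) \<in> H}"

definition cover :: "'g set \<Rightarrow> (nat \<Rightarrow> 'g) \<Rightarrow> nat \<Rightarrow> 'g set" where
  "cover H c m = {v \<in> carrier G. \<exists>l<m. v \<otimes>\<^bsub>G\<^esub> inv\<^bsub>G\<^esub> (c l) \<in> H}"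

lemma normalises_conj:
  assumes "normalises c H" "subgroup H G" "h \<in> H"
  shows "c \<otimes>\<^bsub>G\<^esub> h \<otimes>\<^bsub>G\<^esub> inv\<^bsub>G\<^esub> c \<in> H"
proof -
  have "h \<in> carrier G" "c \<in> carrier G"
    using assms subgroup.mem_carrier unfolding normalises_def by fast+
  moreover from this have "inv\<^bsub>G\<^esub> c \<otimes>\<^bsub>G\<^esub> (c \<otimes>\<^bsub>G\<^esub> h) \<in> H"
    using assms by (simp add: G.inv_cancel_left)
  ultimately show ?thesis
    using assms by (simp add: normalises_def)
qed

text \<open>This provides the absorption that \<open>restr_in_lead\<close> requires. Conjugation by
  \<open>c j\<close> keeps \<open>h\<close> in \<open>H\<close> while moving it past
  \<open>c j\<close>.\<close>

lemma trail_absorb: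
  assumes c: "\<And>j. normalises (c j) H" and H: "subgroup H G" and h: "h \<in> H" and u: "u \<in> trail H c j"
  shows "h \<otimes>\<^bsub>G\<^esub> u \<in> trail H c j"
proof -
  have cc: "c i \<in> carrier G" for i using c by (simp add: normalises_def)
  have hc: "h \<in> carrier G" using H h by (rule subgroup.mem_carrier)
  obtain l where l: "l \<le> j" "c j \<otimes>\<^bsub>G\<^esub> u \<otimes>\<^bsub>G\<^esub> inv\<^bsub>G\<^esub> (c l) \<in> H" and uc: "u \<in> carrier G"
    using u by (auto simp: trail_def)
  have "(c j \<otimes>\<^bsub>G\<^esub> h \<otimes>\<^bsub>G\<^esub> inv\<^bsub>G\<^esub> (c j)) \<otimes>\<^bsub>G\<^esub> (c j \<otimes>\<^bsub>G\<^esub> u \<otimes>\<^bsub>G\<^esub> inv\<^bsub>G\<^esub> (c l)) \<in> H"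
    by (intro subgroup.m_closed[OF H] normalises_conj c H h l)
  then have "c j \<otimes>\<^bsub>G\<^esub> (h \<otimes>\<^bsub>G\<^esub> u) \<otimes>\<^bsub>G\<^esub> inv\<^bsub>G\<^esub> (c l) \<in> H"
    using cc hc uc by (simp add: G.m_assoc G.inv_cancel_left)
  then show ?thesis
    using hc uc l by (auto simp: trail_def)
qed

text \<open>Support in the first j + 1 cosets, seen from \<open>g\<close>, is the same as support in
  the trail, seen from the last of these cosets.\<close>

lemma shift_trail:
  assumes c: "\<And>j. normalises (c j) H" and g: "g \<in> carrier G"
  shows "shift (g \<otimes>\<^bsub>G\<^esub> c j) (trail H c j) = shift g (cover H c (Suc j))"
proof -
  have cc: "c i \<in> carrier G" for i using c by (simp add: normalises_def)
  show ?thesis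
    using g cc by (auto simp: shift_def trail_def cover_def G.inv_mult_group G.m_assoc
        G.inv_cancel_left less_Suc_eq_le)
qed

lemma shift_normalised:
  assumes c: "normalises c H" and g: "g \<in> carrier G" and h: "h \<in> carrier G"
  shows "h \<in> shift (g \<otimes>\<^bsub>G\<^esub> c) H \<longleftrightarrow> inv\<^bsub>G\<^esub> g \<otimes>\<^bsub>G\<^esub> h \<otimes>\<^bsub>G\<^esub> inv\<^bsub>G\<^esub> c \<in> H"
  using assms by (simp add: shift_def normalises_def G.inv_mult_group G.m_assoc)

text \<open>Division with remainder, by induction on the number of cosets. The part of
  \<open>y\<close> in the last coset is also the part of some \<open>x\<close> in \<open>I\<close>
  whose support is no larger, so y - x lies in \<open>J\<close> and needs one coset less.\<close>

lemma mem_if_lead_subset: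
  assumes c: "\<And>j. normalises (c j) H" and H: "subgroup H G"
    and I: "left_ideal I S" and J: "left_ideal J S" and "I \<subseteq> J"
    and lead: "\<And>j. j < m \<Longrightarrow> lead H (trail H c j) J \<subseteq> lead H (trail H c j) I"
    and y: "y \<in> J" and g: "g \<in> carrier G"
    and supp: "\<And>h. h \<in> carrier G \<Longrightarrow> h \<notin> shift g (cover H c m) \<Longrightarrow> cmp y h = \<zero>"
  shows "y \<in> I"
  using lead y supp
proof (induction m arbitrary: y)
  case 0
  note I' = left_ideal_simps[OF I] note J' = left_ideal_simps[OF J]
  \<comment> \<open>With no cosets the cover is empty, so every component of \<open>y\<close>
    vanishes.\<close>
  have "y = \<zero>"
    using 0 J'(1) by (intro cmp_eqI[of y "\<zero>"]) (auto simp: shift_def cover_def)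
  then show ?case using I' by simp
next
  case (Suc m)
  note I' = left_ideal_simps[OF I] note J' = left_ideal_simps[OF J]
  have cc: "c i \<in> carrier G" for i using c by (simp add: normalises_def)
  let ?g = "g \<otimes>\<^bsub>G\<^esub> c m"
  have gc: "?g \<in> carrier G" using g cc by simp
  have sh: "shift ?g (trail H c m) = shift g (cover H c (Suc m))"
    by (rule shift_trail[OF c g])
  have yc: "y \<in> carrier S" using Suc.prems J' by auto
  have "restr (shift ?g H) y \<in> lead H (trail H c m) J"
    by (rule restr_in_lead[OF H J Suc.prems(2) gc])
      (use Suc.prems(3) sh trail_absorb[OF c H] in auto)
  then have "restr (shift ?g H) y \<in> lead H (trail H c m) I"
    using Suc.prems(1) by blast
  then obtain x where x: "x \<in> I"
    "\<And>h. h \<in> carrier G \<Longrightarrow> h \<notin> shift ?g (trail H c m) \<Longrightarrow> cmp x h = \<zero>"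
    "\<And>h. h \<in> shift ?g H \<Longrightarrow> cmp x h = cmp (restr (shift ?g H) y) h"
    by (rule leadE[OF _ gc]) blast
  have xc: "x \<in> carrier S" using x I' by auto
  have "y \<ominus> x \<in> I"
  proof (rule Suc.IH)
    show "y \<ominus> x \<in> J"
      using J'(3) Suc.prems(2) x(1) \<open>I \<subseteq> J\<close> by blast
    show "lead H (trail H c j) J \<subseteq> lead H (trail H c j) I" if "j < m" for j
      using Suc.prems(1) that by simp
    fix h assume h: "h \<in> carrier G" "h \<notin> shift g (cover H c m)"
    show "cmp (y \<ominus> x) h = \<zero>"
    proof (cases "h \<in> shift ?g H")
      case True
      then show ?thesis
        using x(3)[OF True] h xc yc by (simp add: cmp_diff)
    next
      case False
      \<comment> \<open>As \<open>c m\<close> normalises \<open>H\<close>, the coset at g c_m is the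
        translate by \<open>g\<close> of H c_m, which is all that \<open>cover\<close> gains from m
        to m + 1.\<close>
      then have "h \<notin> shift g (cover H c (Suc m))"
        using h(2) shift_normalised[OF c g h(1), of m] h(1) g
        by (auto simp: shift_def cover_def less_Suc_eq)
      then show ?thesis
        using x(2) Suc.prems(3) sh h xc yc by (simp add: cmp_add cmp_minus minus_eq)
    qed
  qed
  then have "(y \<ominus> x) \<oplus> x \<in> I" using I'(4) x(1) by blast
  then show ?case
    using xc yc by (simp add: a_minus_def a_assoc l_neg)
qed

text \<open>Homogeneity of \<open>J\<close> splits an element into parts on cosets of
  \<open>H'\<close>, each of finite support. The hypothesis \<open>cover\<close> carries the
  information about H'/H, and \<open>P\<close> selects the leading ideals to compare: finitely many
  for a finite quotient, all of them for a cyclic one. The base point \<open>g'\<close> may differ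
  from \<open>g\<close>.\<close>

lemma homog_subset_if_lead_subset:
  assumes c: "\<And>j. normalises (c j) H" and H: "subgroup H G" and H': "subgroup H' G"
    and I: "left_ideal I S" and J: "homog H' J" and IJ: "I \<subseteq> J"
    and lead: "\<And>j. P j \<Longrightarrow> lead H (trail H c j) J \<subseteq> lead H (trail H c j) I"
    and cover: "\<And>g F. \<lbrakk>g \<in> carrier G; finite F; F \<subseteq> shift g H'\<rbrakk>
        \<Longrightarrow> \<exists>g'\<in>carrier G. \<exists>m. (\<forall>j<m. P j) \<and> F \<subseteq> shift g' (cover H c m)"
  shows "J \<subseteq> I"
proof
  fix y assume y: "y \<in> J"
  have J': "left_ideal J S" using J by (simp add: homog_def)
  have yc: "y \<in> carrier S" using y left_ideal_simps(1)[OF J'] by auto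
  show "y \<in> I"
  proof (rule mem_if_restr_mem[OF H' I yc])
    fix g assume g: "g \<in> carrier G"
    let ?y = "restr (shift g H') y"
    have "{h \<in> carrier G. cmp ?y h \<noteq> \<zero>} \<subseteq> shift g H'"
      using yc by (auto split: if_splits)
    then obtain g' m where g': "g' \<in> carrier G" and P: "\<And>j. j < m \<Longrightarrow> P j"
      and F: "{h \<in> carrier G. cmp ?y h \<noteq> \<zero>} \<subseteq> shift g' (cover H c m)"
      using cover[OF g finite_support[OF restr_closed[OF yc]]] by blast
    show "?y \<in> I"
    proof (rule mem_if_lead_subset[OF c H I J' IJ _ _ g'])
      show "lead H (trail H c j) J \<subseteq> lead H (trail H c j) I" if "j < m" for j
        using lead P that by blast
      show "?y \<in> J" using J y g by (simp add: homog_def)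
      show "cmp ?y h = \<zero>" if "h \<in> carrier G" "h \<notin> shift g' (cover H c m)" for h
        using F that by blast
    qed
  qed
qed

section \<open>Climbing the subnormal series\<close>

text \<open>The same m cosets cover every coset of \<open>H'\<close>, so stabilising m chains of
  leading ideals is enough.\<close>

lemma acc_homog_finite:
  fixes c :: "nat \<Rightarrow> 'g"
  assumes acc: "acc_on (homog H)" and H: "subgroup H G" and H': "subgroup H' G"
    and c: "\<And>j. normalises (c j) H"
    and reps: "\<And>h. h \<in> H' \<Longrightarrow> \<exists>l<m. h \<otimes>\<^bsub>G\<^esub> inv\<^bsub>G\<^esub> (c l) \<in> H"
  shows "acc_on (homog H')"
  unfolding acc_on_def
proof (intro allI impI, elim conjE)
  fix I :: "nat \<Rightarrow> 'a set"
  assume I: "\<forall>n. homog H' (I n)" and mono: "\<forall>n. I n \<subseteq> I (Suc n)"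
  have ideal: "left_ideal (I n) S" for n using I by (simp add: homog_def)
  obtain N where N: "\<forall>n\<ge>N. \<forall>j<m. lead H (trail H c j) (I n) = lead H (trail H c j) (I N)"
    using acc_on_finite_family[OF acc, of "\<lambda>j n. lead H (trail H c j) (I n)" m]
      homog_lead[OF H ideal] lead_mono mono by blast
  have "I n = I N" if "n \<ge> N" for n
  proof
    show IN: "I N \<subseteq> I n" using mono that by (simp add: lift_Suc_mono_le)
    show "I n \<subseteq> I N"
    proof (rule homog_subset_if_lead_subset[OF c H H' ideal _ IN, where P = "\<lambda>j. j < m"])
      show "homog H' (I n)" using I by blast
      show "lead H (trail H c j) (I n) \<subseteq> lead H (trail H c j) (I N)" if "j < m" for j
        using N that \<open>n \<ge> N\<close> by blast
      fix g F assume g: "g \<in> carrier G" and F: "F \<subseteq> shift g H'"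
      have "F \<subseteq> shift g (cover H c m)"
        using F g reps by (auto simp: shift_def cover_def)
      then show "\<exists>g'\<in>carrier G. \<exists>k. (\<forall>j<k. j < m) \<and> F \<subseteq> shift g' (cover H c k)"
        using g by blast
    qed
  qed
  then show "\<exists>N. \<forall>n\<ge>N. I n = I N" by blast
qed

lemma normalises_pow:
  assumes t: "normalises t H" and "normalises (inv\<^bsub>G\<^esub> t) H"
  shows "normalises (inv\<^bsub>G\<^esub> (t [^]\<^bsub>G\<^esub> (k::nat))) H \<and> normalises (t [^]\<^bsub>G\<^esub> k) H"
proof -
  have tc: "t \<in> carrier G" using t by (simp add: normalises_def)
  have mult: "normalises (a \<otimes>\<^bsub>G\<^esub> b) H" if a: "normalises a H" and b: "normalises b H" for a b
  proof -
    have ac: "a \<in> carrier G" "b \<in> carrier G" using a b by (auto simp: normalises_def)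
    have "inv\<^bsub>G\<^esub> (a \<otimes>\<^bsub>G\<^esub> b) \<otimes>\<^bsub>G\<^esub> h \<in> H \<longleftrightarrow> h \<otimes>\<^bsub>G\<^esub> inv\<^bsub>G\<^esub> (a \<otimes>\<^bsub>G\<^esub> b) \<in> H" if h: "h \<in> carrier G" for h
    proof -
      have "inv\<^bsub>G\<^esub> b \<otimes>\<^bsub>G\<^esub> (inv\<^bsub>G\<^esub> a \<otimes>\<^bsub>G\<^esub> h) \<in> H \<longleftrightarrow> inv\<^bsub>G\<^esub> a \<otimes>\<^bsub>G\<^esub> h \<otimes>\<^bsub>G\<^esub> inv\<^bsub>G\<^esub> b \<in> H"
        using b ac h by (simp add: normalises_def)
      also have "\<dots> \<longleftrightarrow> inv\<^bsub>G\<^esub> a \<otimes>\<^bsub>G\<^esub> (h \<otimes>\<^bsub>G\<^esub> inv\<^bsub>G\<^esub> b) \<in> H"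
        using ac h by (simp add: G.m_assoc)
      also have "\<dots> \<longleftrightarrow> h \<otimes>\<^bsub>G\<^esub> inv\<^bsub>G\<^esub> b \<otimes>\<^bsub>G\<^esub> inv\<^bsub>G\<^esub> a \<in> H"
        using a ac h by (simp add: normalises_def)
      finally show ?thesis
        using ac h by (simp add: G.inv_mult_group G.m_assoc)
    qed
    then show ?thesis using ac by (simp add: normalises_def)
  qed
  have one: "normalises \<one>\<^bsub>G\<^esub> H" by (simp add: normalises_def)
  show ?thesis
    by (induction k) (use assms tc in \<open>auto simp: one mult G.inv_mult_group\<close>)
qed

text \<open>Supports can need arbitrarily many powers of \<open>t\<close>, so all leading ideals
  must stabilise at a common index. This comes from \<open>acc_on_double_chain\<close>, as they
  increase in both indices.\<close>

lemma acc_homog_cyclic: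
  assumes acc: "acc_on (homog H)" and H: "subgroup H G" and H': "subgroup H' G"
    and t: "normalises t H" and t': "normalises (inv\<^bsub>G\<^esub> t) H"
    and reps: "\<And>h. h \<in> H' \<Longrightarrow> \<exists>k::int. h \<otimes>\<^bsub>G\<^esub> t [^]\<^bsub>G\<^esub> k \<in> H"
  shows "acc_on (homog H')"
  unfolding acc_on_def
proof (intro allI impI, elim conjE)
  fix I :: "nat \<Rightarrow> 'a set"
  assume I: "\<forall>n. homog H' (I n)" and mono: "\<forall>n. I n \<subseteq> I (Suc n)"
  have ideal: "left_ideal (I n) S" for n using I by (simp add: homog_def)
  have tc: "t \<in> carrier G" using t by (simp add: normalises_def)
  \<comment> \<open>Negative powers make \<open>trail H c j\<close> the union of the \<open>H t\<^sup>i\<close> with \<open>i \<le> j\<close>, which increases with \<open>j\<close>.\<close>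
  define c where "c = (\<lambda>j::nat. inv\<^bsub>G\<^esub> (t [^]\<^bsub>G\<^esub> j))"
  have c: "normalises (c j) H" for j
    using normalises_pow[OF t t'] by (simp add: c_def)
  have trail_mono: "trail H c j \<subseteq> trail H c (Suc j)" for j
  proof
    fix u assume "u \<in> trail H c j"
    then obtain l where u: "u \<in> carrier G" "l \<le> j" "c j \<otimes>\<^bsub>G\<^esub> u \<otimes>\<^bsub>G\<^esub> inv\<^bsub>G\<^esub> (c l) \<in> H"
      by (auto simp: trail_def)
    \<comment> \<open>Conjugating by the inverse of \<open>t\<close> raises both exponents by one,
      so the index l at j becomes l + 1 at j + 1.\<close>
    have "inv\<^bsub>G\<^esub> t \<otimes>\<^bsub>G\<^esub> (c j \<otimes>\<^bsub>G\<^esub> u \<otimes>\<^bsub>G\<^esub> inv\<^bsub>G\<^esub> (c l)) \<otimes>\<^bsub>G\<^esub> inv\<^bsub>G\<^esub> (inv\<^bsub>G\<^esub> t) \<in> H"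
      by (rule normalises_conj[OF t' H u(3)])
    then have "c (Suc j) \<otimes>\<^bsub>G\<^esub> u \<otimes>\<^bsub>G\<^esub> inv\<^bsub>G\<^esub> (c (Suc l)) \<in> H"
      using u(1) tc by (simp add: c_def G.inv_mult_group G.m_assoc)
    then show "u \<in> trail H c (Suc j)"
      using u unfolding trail_def by (intro CollectI conjI exI[of _ "Suc l"]) auto
  qed
  obtain N where N: "\<forall>n\<ge>N. \<forall>j. lead H (trail H c j) (I n) = lead H (trail H c j) (I N)"
    using acc_on_double_chain[OF acc, of "\<lambda>j n. lead H (trail H c j) (I n)"]
      homog_lead[OF H ideal] lead_mono[OF trail_mono] lead_mono[OF order.refl] mono by blast
  have "I n = I N" if "n \<ge> N" for n
  proof
    show IN: "I N \<subseteq> I n" using mono that by (simp add: lift_Suc_mono_le)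
    show "I n \<subseteq> I N"
    proof (rule homog_subset_if_lead_subset[OF c H H' ideal _ IN, where P = "\<lambda>j. True"])
      show "homog H' (I n)" using I by blast
      show "lead H (trail H c j) (I n) \<subseteq> lead H (trail H c j) (I N)" for j
        using N \<open>n \<ge> N\<close> by blast
      fix g F assume g: "g \<in> carrier G" and fin: "finite F" and F: "F \<subseteq> shift g H'"
      have "\<forall>f\<in>F. \<exists>k::int. inv\<^bsub>G\<^esub> g \<otimes>\<^bsub>G\<^esub> f \<otimes>\<^bsub>G\<^esub> t [^]\<^bsub>G\<^esub> k \<in> H"
        using F reps by (auto simp: shift_def)
      then obtain k :: "'g \<Rightarrow> int" where k: "\<And>f. f \<in> F \<Longrightarrow> inv\<^bsub>G\<^esub> g \<otimes>\<^bsub>G\<^esub> f \<otimes>\<^bsub>G\<^esub> t [^]\<^bsub>G\<^esub> k f \<in> H"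
        by metis
      \<comment> \<open>The inserted 0 keeps the maximum meaningful when \<open>F\<close> is
        empty.\<close>
      define M where "M = nat (Max (insert 0 ((\<lambda>f. \<bar>k f\<bar>) ` F)))"
      have M: "\<bar>k f\<bar> \<le> int M" if "f \<in> F" for f
      proof -
        have "\<bar>k f\<bar> \<le> Max (insert 0 ((\<lambda>f. \<bar>k f\<bar>) ` F))"
          using fin that by (intro Max_ge) auto
        then show ?thesis by (simp add: M_def)
      qed
      \<comment> \<open>Exponents between -M and M become indices from 0 to 2M once the base point
        is moved by t^M; hence 2M + 1 cosets suffice.\<close>
      let ?g = "g \<otimes>\<^bsub>G\<^esub> t [^]\<^bsub>G\<^esub> M"
      have "F \<subseteq> shift ?g (cover H c (Suc (2 * M)))"
      proof
        fix f assume f: "f \<in> F"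
        have fc: "f \<in> carrier G" using F f by (auto simp: shift_def)
        let ?l = "nat (k f + int M)"
        have l: "?l < Suc (2 * M)" "int ?l = k f + int M" using M[OF f] by auto
        have "normalises (inv\<^bsub>G\<^esub> (t [^]\<^bsub>G\<^esub> M)) H"
          using normalises_pow[OF t t'] by blast
        then have "inv\<^bsub>G\<^esub> (t [^]\<^bsub>G\<^esub> M) \<otimes>\<^bsub>G\<^esub> (inv\<^bsub>G\<^esub> g \<otimes>\<^bsub>G\<^esub> f \<otimes>\<^bsub>G\<^esub> t [^]\<^bsub>G\<^esub> k f)
            \<otimes>\<^bsub>G\<^esub> inv\<^bsub>G\<^esub> (inv\<^bsub>G\<^esub> (t [^]\<^bsub>G\<^esub> M)) \<in> H"
          by (rule normalises_conj[OF _ H k[OF f]])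
        moreover have "t [^]\<^bsub>G\<^esub> k f \<otimes>\<^bsub>G\<^esub> t [^]\<^bsub>G\<^esub> M = t [^]\<^bsub>G\<^esub> ?l"
          using tc l(2) by (metis G.int_pow_mult int_pow_int)
        ultimately have "inv\<^bsub>G\<^esub> ?g \<otimes>\<^bsub>G\<^esub> f \<otimes>\<^bsub>G\<^esub> inv\<^bsub>G\<^esub> (c ?l) \<in> H"
          using tc g fc by (simp add: c_def G.inv_mult_group G.m_assoc)
        then show "f \<in> shift ?g (cover H c (Suc (2 * M)))"
          using l(1) fc g tc by (auto simp: shift_def cover_def)
      qed
      then show "\<exists>g'\<in>carrier G. \<exists>m. (\<forall>j<m. True) \<and> F \<subseteq> shift g' (cover H c m)"
        using g tc by blast
    qed
  qed
  then show "\<exists>N. \<forall>n\<ge>N. I n = I N" by blast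
qed

end

section \<open>Coset representatives in cyclic and finite quotients\<close>

lemma (in group) cyclic_quotient_representatives:
  assumes K: "subgroup K G" and N: "normal N (G\<lparr>carrier := K\<rparr>)"
    and cyc: "cyclic_group ((G\<lparr>carrier := K\<rparr>) Mod N)"
  shows "\<exists>t\<in>K. \<forall>h\<in>K. \<exists>k::int. h \<otimes> t [^] k \<in> N"
proof -
  let ?K = "G\<lparr>carrier := K\<rparr>"
  interpret N: normal N ?K by (rule N)
  interpret Q: group "?K Mod N" by (rule N.factorgroup_is_group)
  have Kc: "h \<in> carrier G" if "h \<in> K" for h
    using K that by (rule subgroup.mem_carrier)
  obtain C where CQ: "C \<in> carrier (?K Mod N)"
    and C: "carrier (?K Mod N) = range (\<lambda>k::int. C [^]\<^bsub>?K Mod N\<^esub> k)"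
    using cyc Q.cyclic_group by blast
  obtain t where t: "t \<in> K" "C = N #>\<^bsub>?K\<^esub> t"
    using CQ by (auto simp: carrier_FactGroup)
  \<comment> \<open>The projection to the quotient is a homomorphism, and integer powers in
    \<open>K\<close> agree with those in the whole group.\<close>
  have pow: "C [^]\<^bsub>?K Mod N\<^esub> k = N #>\<^bsub>?K\<^esub> (t [^] k)" for k :: int
    using hom_int_pow[OF N.r_coset_hom_Mod _ _ Q.group_axioms, of t k] t N.is_group
    by (simp flip: int_pow_consistent[OF K])
  have "\<exists>k::int. h \<otimes> t [^] k \<in> N" if h: "h \<in> K" for h
  proof -
    have "N #>\<^bsub>?K\<^esub> h \<in> carrier (?K Mod N)"
      using h by (auto simp: carrier_FactGroup)
    then obtain k :: int where k: "N #>\<^bsub>?K\<^esub> h = N #>\<^bsub>?K\<^esub> (t [^] k)"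
      using C pow by auto
    have "\<one> \<in> N" using subgroup.one_closed[OF N.subgroup_axioms] by simp
    then have "h \<in> N #>\<^bsub>?K\<^esub> h"
      using Kc[OF h] by (force simp: r_coset_def)
    then obtain n where n: "n \<in> N" "h = n \<otimes> t [^] k"
      unfolding k by (auto simp: r_coset_def)
    have "n \<in> K" using N.subset n by auto
    have "h \<otimes> t [^] (- k) = n \<otimes> (t [^] k \<otimes> t [^] (- k))"
      using n Kc[OF \<open>n \<in> K\<close>] Kc[OF t(1)] by (simp add: m_assoc)
    also have "\<dots> = n"
      using Kc[OF \<open>n \<in> K\<close>] Kc[OF t(1)] by (simp add: int_pow_neg)
    finally show ?thesis using n(1) by metis
  qed
  then show ?thesis using t by blast
qed

lemma (in group) finite_quotient_representatives:
  assumes N: "subgroup N G" and fin: "finite (carrier (G Mod N))"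
  shows "\<exists>(c :: nat \<Rightarrow> 'a) m. (\<forall>j. c j \<in> carrier G) \<and> (\<forall>h\<in>carrier G. \<exists>l<m. h \<otimes> inv (c l) \<in> N)"
proof -
  \<comment> \<open>A transversal: one chosen representative for each coset.\<close>
  define T where "T = (\<lambda>C. SOME x. x \<in> carrier G \<and> C = N #> x) ` carrier (G Mod N)"
  have rep: "(SOME x. x \<in> carrier G \<and> C = N #> x) \<in> carrier G \<and>
      C = N #> (SOME x. x \<in> carrier G \<and> C = N #> x)" if "C \<in> carrier (G Mod N)" for C
    by (rule someI_ex) (use that in \<open>auto simp: carrier_FactGroup\<close>)
  have "finite T" using fin by (simp add: T_def)
  then obtain m f where f: "T = f ` {i::nat. i < m}"
    using finite_imp_nat_seg_image_inj_on by blast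
  have Tc: "x \<in> carrier G" if "x \<in> T" for x
    using that rep unfolding T_def by blast
  \<comment> \<open>The default value keeps \<open>c\<close> in the carrier beyond m, since
    \<open>acc_homog_finite\<close> wants every \<open>c j\<close> to normalise the
    subgroup.\<close>
  define c where "c = (\<lambda>j. if j < m then f j else \<one>)"
  have "\<exists>l<m. h \<otimes> inv (c l) \<in> N" if h: "h \<in> carrier G" for h
  proof -
    have "N #> h \<in> carrier (G Mod N)" using h by (auto simp: carrier_FactGroup)
    then obtain x where x: "x \<in> T" "N #> h = N #> x"
      using rep unfolding T_def by blast
    then obtain l where l: "l < m" "x = c l"
      using f by (auto simp: c_def)
    have "h \<in> N #> x"
      using x(2) h N by (metis rcos_self)
    then obtain n where n: "n \<in> N" "h = n \<otimes> x"
      by (auto simp: r_coset_def)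
    then have "h \<otimes> inv x = n"
      using Tc[OF x(1)] subgroup.mem_carrier[OF N n(1)] by (simp add: m_assoc)
    then show ?thesis using n l by blast
  qed
  moreover have "c j \<in> carrier G" for j using Tc f by (auto simp: c_def)
  ultimately show ?thesis by blast
qed

section \<open>Ascent from the trivial subgroup to the whole group\<close>

context graded_components
begin

lemma normal_imp_normalises:
  assumes K: "subgroup K G" and N: "normal N (G\<lparr>carrier := K\<rparr>)" and c: "c \<in> K"
  shows "normalises c N"
proof -
  interpret N: normal N "G\<lparr>carrier := K\<rparr>" by (rule N)
  have Kc: "x \<in> carrier G" if "x \<in> K" for x
    using K that by (rule subgroup.mem_carrier)
  have conj: "inv\<^bsub>G\<^esub> c \<otimes>\<^bsub>G\<^esub> n \<otimes>\<^bsub>G\<^esub> c \<in> N" "c \<otimes>\<^bsub>G\<^esub> n \<otimes>\<^bsub>G\<^esub> inv\<^bsub>G\<^esub> c \<in> N" if "n \<in> N" for n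
    using N.inv_op_closed1[of c n] N.inv_op_closed2[of c n] that c G.m_inv_consistent[OF K c] by auto
  have "inv\<^bsub>G\<^esub> c \<otimes>\<^bsub>G\<^esub> h \<in> N \<longleftrightarrow> h \<otimes>\<^bsub>G\<^esub> inv\<^bsub>G\<^esub> c \<in> N" if h: "h \<in> carrier G" for h
  proof
    assume "inv\<^bsub>G\<^esub> c \<otimes>\<^bsub>G\<^esub> h \<in> N"
    from conj(2)[OF this] show "h \<otimes>\<^bsub>G\<^esub> inv\<^bsub>G\<^esub> c \<in> N"
      using h Kc[OF c] by (simp add: G.m_assoc G.inv_cancel_left)
  next
    assume "h \<otimes>\<^bsub>G\<^esub> inv\<^bsub>G\<^esub> c \<in> N"
    from conj(1)[OF this] show "inv\<^bsub>G\<^esub> c \<otimes>\<^bsub>G\<^esub> h \<in> N"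
      using h Kc[OF c] by (simp add: G.m_assoc)
  qed
  then show ?thesis using Kc[OF c] by (simp add: normalises_def)
qed

text \<open>The whole group is its only coset, so taking coset parts changes nothing.\<close>

lemma homog_carrier: "homog (carrier G) I \<longleftrightarrow> left_ideal I S"
proof -
  have "restr (shift g (carrier G)) x = x" if "g \<in> carrier G" "x \<in> carrier S" for g x
    using that by (intro cmp_eqI[OF restr_closed]) (auto simp: shift_def)
  then show ?thesis
    using left_ideal_simps(1) by (auto simp: homog_def subset_iff)
qed

lemma acc_homog_polycyclic_by_finite:
  assumes G: "polycyclic_by_finite G" and acc: "acc_on (homog {\<one>\<^bsub>G\<^esub>})"
  shows "left_noetherian S"
proof -
  obtain n H where H0: "H 0 = {\<one>\<^bsub>G\<^esub>}" and Hn: "H (Suc n) = carrier G"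
    and sub: "\<And>i. i \<le> Suc n \<Longrightarrow> subgroup (H i) G"
    and nor: "\<And>i. i \<le> n \<Longrightarrow> normal (H i) (G\<lparr>carrier := H (Suc i)\<rparr>)"
    and fin: "finite (carrier (G Mod H n))"
    and cyc: "\<And>i. i < n \<Longrightarrow> cyclic_group ((G\<lparr>carrier := H (Suc i)\<rparr>) Mod (H i))"
    using G unfolding polycyclic_by_finite_def by metis
  have "acc_on (homog (H i))" if "i \<le> n" for i
    using that
  proof (induction i)
    case 0
    then show ?case using acc H0 by simp
  next
    case (Suc i)
    have Hi: "subgroup (H i) G" and Hi': "subgroup (H (Suc i)) G"
      and N: "normal (H i) (G\<lparr>carrier := H (Suc i)\<rparr>)"
      using sub nor Suc.prems by auto
    obtain t where t: "t \<in> H (Suc i)"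
      and reps: "\<And>h. h \<in> H (Suc i) \<Longrightarrow> \<exists>k::int. h \<otimes>\<^bsub>G\<^esub> t [^]\<^bsub>G\<^esub> k \<in> H i"
      using G.cyclic_quotient_representatives[OF Hi' N] cyc Suc.prems by auto
    show ?case
    proof (rule acc_homog_cyclic[OF _ Hi Hi' _ _ reps])
      show "acc_on (homog (H i))" using Suc by simp
      show "normalises t (H i)" "normalises (inv\<^bsub>G\<^esub> t) (H i)"
        using normal_imp_normalises[OF Hi' N] t subgroup.m_inv_closed[OF Hi'] by auto
    qed
  qed
  then have accn: "acc_on (homog (H n))" by simp
  obtain c :: "nat \<Rightarrow> 'g" and m where c: "\<And>j. c j \<in> carrier G"
    and reps: "\<And>h. h \<in> carrier G \<Longrightarrow> \<exists>l<m. h \<otimes>\<^bsub>G\<^esub> inv\<^bsub>G\<^esub> (c l) \<in> H n"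
    using G.finite_quotient_representatives[OF sub[of n] fin] by auto
  have "acc_on (homog (carrier G))"
  proof (rule acc_homog_finite[OF accn _ G.subgroup_self _ reps])
    show "subgroup (H n) G" using sub by simp
    show "normalises (c j) (H n)" for j
      using normal_imp_normalises[OF G.subgroup_self _ c] nor[of n] Hn by simp
  qed
  then show ?thesis
    unfolding left_noetherian_iff_acc_on homog_carrier[symmetric] .
qed

section \<open>Comparison with the principal component\<close>

lemma left_ideal_principal_iff:
  "left_ideal I (S\<lparr>carrier := Sg \<one>\<^bsub>G\<^esub>\<rparr>) \<longleftrightarrow>
     I \<subseteq> Sg \<one>\<^bsub>G\<^esub> \<and> additive_subgroup I S \<and> (\<forall>r\<in>Sg \<one>\<^bsub>G\<^esub>. \<forall>x\<in>I. r \<otimes> x \<in> I)"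
proof -
  let ?R = "S\<lparr>carrier := Sg \<one>\<^bsub>G\<^esub>\<rparr>"
  have sub: "subgroup (Sg \<one>\<^bsub>G\<^esub>) (add_monoid S)"
    using Sg_subgroup[OF G.one_closed] by (simp add: additive_subgroup_def)
  have R: "add_monoid ?R = (add_monoid S)\<lparr>carrier := Sg \<one>\<^bsub>G\<^esub>\<rparr>" by simp
  have "subgroup I (add_monoid ?R) \<longleftrightarrow> I \<subseteq> Sg \<one>\<^bsub>G\<^esub> \<and> subgroup I (add_monoid S)"
  proof
    assume I: "subgroup I (add_monoid ?R)"
    then have "subgroup I (add_monoid S)"
      unfolding R by (rule add.incl_subgroup[OF sub])
    moreover have "I \<subseteq> Sg \<one>\<^bsub>G\<^esub>" using subgroup.subset[OF I] by simp
    ultimately show "I \<subseteq> Sg \<one>\<^bsub>G\<^esub> \<and> subgroup I (add_monoid S)" by blast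
  next
    assume "I \<subseteq> Sg \<one>\<^bsub>G\<^esub> \<and> subgroup I (add_monoid S)"
    then show "subgroup I (add_monoid ?R)"
      unfolding R using add.subgroup_incl[OF _ sub] by blast
  qed
  then show ?thesis by (auto simp: left_ideal_def additive_subgroup_def)
qed

text \<open>Passing from \<open>I n\<close> to \<open>E n\<close> preserves inclusions and is undone
  by intersecting with the principal component, so stability of the chain in \<open>S\<close>
  descends.\<close>

lemma left_noetherian_principal:
  assumes "left_noetherian S"
  shows "left_noetherian (S\<lparr>carrier := Sg \<one>\<^bsub>G\<^esub>\<rparr>)"
  unfolding left_noetherian_def
proof (intro allI impI, elim conjE)
  fix I :: "nat \<Rightarrow> 'a set"
  assume I: "\<forall>n. left_ideal (I n) (S\<lparr>carrier := Sg \<one>\<^bsub>G\<^esub>\<rparr>)" and mono: "\<forall>n. I n \<subseteq> I (Suc n)"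
  \<comment> \<open>The largest graded left ideal of \<open>S\<close> whose intersection with the principal component is \<open>I n\<close>.\<close>
  define E where "E n = {x \<in> carrier S. \<forall>g\<in>carrier G. \<forall>s\<in>Sg (inv\<^bsub>G\<^esub> g). s \<otimes> cmp x g \<in> I n}" for n
  have add: "additive_subgroup (I n) S" and IR: "I n \<subseteq> Sg \<one>\<^bsub>G\<^esub>"
    and mult: "\<And>r x. r \<in> Sg \<one>\<^bsub>G\<^esub> \<Longrightarrow> x \<in> I n \<Longrightarrow> r \<otimes> x \<in> I n" for n
    using I left_ideal_principal_iff by auto
  have diff: "x \<ominus> y \<in> I n" if "x \<in> I n" "y \<in> I n" for x y n
    using that additive_subgroup.a_closed[OF add] additive_subgroup.a_inv_closed[OF add]
    by (simp add: minus_eq)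
  have "left_ideal (E n) S" for n
    unfolding left_ideal_iff
  proof (intro conjI ballI)
    show "E n \<subseteq> carrier S" by (auto simp: E_def)
    show "\<zero> \<in> E n"
      using additive_subgroup.zero_closed[OF add] Sg_carrier[OF G.inv_closed] by (simp add: E_def)
  next
    fix x y assume xy: "x \<in> E n" "y \<in> E n"
    then have "s \<otimes> cmp (x \<ominus> y) g \<in> I n" if "g \<in> carrier G" "s \<in> Sg (inv\<^bsub>G\<^esub> g)" for g s
      using that diff[of "s \<otimes> cmp x g" n "s \<otimes> cmp y g"]
      by (simp add: E_def minus_eq cmp_add cmp_minus r_distr r_minus Sg_carrier[of "inv\<^bsub>G\<^esub> g" s])
    then show "x \<ominus> y \<in> E n" using xy by (simp add: E_def)
  next
    fix k r x assume k: "k \<in> carrier G" and r: "r \<in> Sg k" and x: "x \<in> E n"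
    have xc: "x \<in> carrier S" using x by (simp add: E_def)
    have "s \<otimes> cmp (r \<otimes> x) g \<in> I n" if g: "g \<in> carrier G" and s: "s \<in> Sg (inv\<^bsub>G\<^esub> g)" for g s
    proof -
      let ?g = "inv\<^bsub>G\<^esub> k \<otimes>\<^bsub>G\<^esub> g"
      \<comment> \<open>The product has degree g^-1 k, the inverse of k^-1 g, so it is one of the
        factors that test the component of \<open>x\<close> at k^-1 g.\<close>
      have "s \<otimes> r \<in> Sg (inv\<^bsub>G\<^esub> ?g)"
        using Sg_mult[OF _ k s r] g k by (simp add: G.inv_mult_group)
      then have "s \<otimes> r \<otimes> cmp x ?g \<in> I n"
        using x g k by (simp add: E_def)
      then show ?thesis
        using g k r s xc Sg_carrier[of "inv\<^bsub>G\<^esub> g" s]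
        by (simp add: cmp_mult_homogeneous m_assoc Sg_carrier[of k r])
    qed
    then show "r \<otimes> x \<in> E n" using xc k r by (simp add: E_def Sg_carrier[of k r])
  qed
  moreover have "E n \<subseteq> E (Suc n)" for n using mono by (auto simp: E_def)
  ultimately obtain N where N: "\<And>n. n \<ge> N \<Longrightarrow> E n = E N"
    using assms unfolding left_noetherian_def by metis
  have EI: "E n \<inter> Sg \<one>\<^bsub>G\<^esub> = I n" for n
  proof (intro equalityI subsetI)
    fix x assume x: "x \<in> E n \<inter> Sg \<one>\<^bsub>G\<^esub>"
    \<comment> \<open>Testing at degree one with the factor 1 recovers \<open>x\<close>
      itself.\<close>
    moreover have "\<one> \<in> Sg (inv\<^bsub>G\<^esub> \<one>\<^bsub>G\<^esub>)" using one_in_Sg_one by simp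
    ultimately have "\<one> \<otimes> cmp x \<one>\<^bsub>G\<^esub> \<in> I n"
      unfolding E_def by blast
    then show "x \<in> I n"
      using x Sg_carrier[OF G.one_closed, of x] by (simp add: cmp_homogeneous[of "\<one>\<^bsub>G\<^esub>"])
  next
    fix x assume x: "x \<in> I n"
    then have xR: "x \<in> Sg \<one>\<^bsub>G\<^esub>" using IR by blast
    have "s \<otimes> cmp x g \<in> I n" if "g \<in> carrier G" "s \<in> Sg (inv\<^bsub>G\<^esub> g)" for g s
      using that mult[of s x] x xR Sg_carrier[of "inv\<^bsub>G\<^esub> g" s] additive_subgroup.zero_closed[OF add]
      by (auto simp: cmp_homogeneous[of "\<one>\<^bsub>G\<^esub>"])
    then show "x \<in> E n \<inter> Sg \<one>\<^bsub>G\<^esub>" using xR Sg_carrier[OF G.one_closed xR] by (simp add: E_def)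
  qed
  show "\<exists>N. \<forall>n\<ge>N. I n = I N"
    using N EI by metis
qed

text \<open>A graded left ideal is determined by its part in the principal component: for y of
  degree g, y = epsilon y is a sum of terms a(by) in which by has degree one.\<close>

lemma acc_homog_one:
  assumes noeth: "left_noetherian (S\<lparr>carrier := Sg \<one>\<^bsub>G\<^esub>\<rparr>)"
    and unit: "\<And>g. g \<in> carrier G \<Longrightarrow>
      \<exists>\<epsilon>\<in>set_prod S (Sg g) (Sg (inv\<^bsub>G\<^esub> g)). \<forall>x\<in>Sg g. \<epsilon> \<otimes> x = x"
  shows "acc_on (homog {\<one>\<^bsub>G\<^esub>})"
  unfolding acc_on_def
proof (intro allI impI, elim conjE)
  fix I :: "nat \<Rightarrow> 'a set"
  assume I: "\<forall>n. homog {\<one>\<^bsub>G\<^esub>} (I n)" and mono: "\<forall>n. I n \<subseteq> I (Suc n)"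
  have ideal: "left_ideal (I n) S" for n using I by (simp add: homog_def)
  have "left_ideal (I n \<inter> Sg \<one>\<^bsub>G\<^esub>) (S\<lparr>carrier := Sg \<one>\<^bsub>G\<^esub>\<rparr>)" for n
  proof -
    have "additive_subgroup (I n \<inter> Sg \<one>\<^bsub>G\<^esub>) S"
      using ideal[of n] Sg_subgroup[OF G.one_closed] add.subgroups_Inter_pair
      by (simp add: left_ideal_def additive_subgroup_def)
    moreover have "r \<otimes> x \<in> Sg \<one>\<^bsub>G\<^esub>" if "r \<in> Sg \<one>\<^bsub>G\<^esub>" "x \<in> Sg \<one>\<^bsub>G\<^esub>" for r x
      using Sg_mult[OF G.one_closed G.one_closed that] by simp
    ultimately show ?thesis
      using left_ideal_simps(5)[OF ideal[of n]] Sg_carrier[OF G.one_closed]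
      unfolding left_ideal_principal_iff by blast
  qed
  moreover have "I n \<inter> Sg \<one>\<^bsub>G\<^esub> \<subseteq> I (Suc n) \<inter> Sg \<one>\<^bsub>G\<^esub>" for n using mono by blast
  ultimately obtain N where N: "\<And>n. n \<ge> N \<Longrightarrow> I n \<inter> Sg \<one>\<^bsub>G\<^esub> = I N \<inter> Sg \<one>\<^bsub>G\<^esub>"
    using acc_onD[OF noeth[unfolded left_noetherian_iff_acc_on], of "\<lambda>n. I n \<inter> Sg \<one>\<^bsub>G\<^esub>"] by metis
  have "I n = I N" if "n \<ge> N" for n
  proof
    show "I N \<subseteq> I n" using mono that by (simp add: lift_Suc_mono_le)
    show "I n \<subseteq> I N"
    proof
      fix y assume y: "y \<in> I n"
      note In = left_ideal_simps[OF ideal[of n]] and IN = left_ideal_simps[OF ideal[of N]]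
      have yc: "y \<in> carrier S" using y In(1) by auto
      show "y \<in> I N"
      proof (rule mem_if_restr_mem[OF G.triv_subgroup ideal yc])
        fix g assume g: "g \<in> carrier G"
        let ?y = "restr (shift g {\<one>\<^bsub>G\<^esub>}) y"
        \<comment> \<open>Cosets of the trivial subgroup are points, so the coset part of
          \<open>y\<close> is its component at \<open>g\<close>.\<close>
        have sh: "h \<in> shift g {\<one>\<^bsub>G\<^esub>} \<longleftrightarrow> h = g" if "h \<in> carrier G" for h
          using that g by (auto simp: shift_def dest: G.inv_equality[of "inv\<^bsub>G\<^esub> g"])
        have "?y = cmp y g"
          by (rule cmp_eqI) (use yc g cmp_in[OF yc g] in \<open>auto simp: sh cmp_homogeneous[of g]\<close>)
        then have yg: "?y \<in> Sg g" using cmp_in[OF yc g] by simp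
        have yI: "?y \<in> I n" using I y g by (simp add: homog_def)
        have ic: "inv\<^bsub>G\<^esub> g \<in> carrier G" using g by simp
        obtain \<epsilon> where \<epsilon>: "\<epsilon> \<in> set_prod S (Sg g) (Sg (inv\<^bsub>G\<^esub> g))" "\<epsilon> \<otimes> ?y = ?y"
          using unit[OF g] yg by blast
        have sub: "Sg g \<subseteq> carrier S" "Sg (inv\<^bsub>G\<^esub> g) \<subseteq> carrier S"
          using Sg_carrier g ic by blast+
        have "\<epsilon> \<otimes> ?y \<in> I N"
          using \<epsilon>(1) sub
        proof (induction \<epsilon> rule: set_prod_induct)
          case zero
          then show ?case using IN(2) yc by simp
        next
          case (mult a b)
          have abc: "a \<in> carrier S" "b \<in> carrier S" using mult sub by auto
          have "b \<otimes> ?y \<in> Sg \<one>\<^bsub>G\<^esub>"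
            using Sg_mult[OF ic g mult(2) yg] g by simp
          moreover have "b \<otimes> ?y \<in> I n"
            using In(5) abc yI by blast
          ultimately have "b \<otimes> ?y \<in> I N" using N[OF that] by blast
          then show ?case
            using IN(5)[OF abc(1)] abc yc by (simp add: m_assoc)
        next
          case (add u v)
          then show ?case using IN(4) yc by (simp add: l_distr)
        qed
        then show "?y \<in> I N" using \<epsilon>(2) by simp
      qed
    qed
  qed
  then show "\<exists>N. \<forall>n\<ge>N. I n = I N" by blast
qed

theorem left_noetherian_iff_principal:
  assumes "polycyclic_by_finite G"
    and "\<And>g. g \<in> carrier G \<Longrightarrow>
      \<exists>\<epsilon>\<in>set_prod S (Sg g) (Sg (inv\<^bsub>G\<^esub> g)). \<forall>x\<in>Sg g. \<epsilon> \<otimes> x = x"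
  shows "left_noetherian S \<longleftrightarrow> left_noetherian (S\<lparr>carrier := Sg \<one>\<^bsub>G\<^esub>\<rparr>)"
  using left_noetherian_principal acc_homog_one acc_homog_polycyclic_by_finite assms by blast

end

section \<open>Existence of the component maps\<close>

definition decomposition ::
  "('a, 'b) ring_scheme \<Rightarrow> ('g, 'c) monoid_scheme \<Rightarrow> ('g \<Rightarrow> 'a set) \<Rightarrow> 'a \<Rightarrow> ('g \<Rightarrow> 'a) \<Rightarrow> bool" where
  "decomposition S G Sg x f \<longleftrightarrow> f \<in> extensional (carrier G) \<and>
     finite {g\<in>carrier G. f g \<noteq> \<zero>\<^bsub>S\<^esub>} \<and> (\<forall>g\<in>carrier G. f g \<in> Sg g) \<and>
     x = finsum S f {g\<in>carrier G. f g \<noteq> \<zero>\<^bsub>S\<^esub>}"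

text \<open>Each property of the component maps is obtained by exhibiting a decomposition and
  appealing to uniqueness.\<close>

lemma graded_ring_components:
  assumes "graded_ring S G Sg"
  shows "graded_components S G Sg (\<lambda>x. THE f. decomposition S G Sg x f)"
proof -
  interpret ring S using assms by (simp add: graded_ring_def)
  interpret G: group G using assms by (simp add: graded_ring_def)
  have sub: "additive_subgroup (Sg g) S" if "g \<in> carrier G" for g
    using assms that by (simp add: graded_ring_def)
  have car: "x \<in> carrier S" if "g \<in> carrier G" "x \<in> Sg g" for g x
    using additive_subgroup.a_Hcarr[OF sub] that by blast
  have ex1: "\<exists>!f. decomposition S G Sg x f" if "x \<in> carrier S" for x
    using assms that by (simp add: graded_ring_def decomposition_def)
  define c where "c = (\<lambda>x. THE f. decomposition S G Sg x f)"
  have c: "decomposition S G Sg x (c x)" if "x \<in> carrier S" for x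
    unfolding c_def using theI'[OF ex1[OF that]] .
  \<comment> \<open>The set \<open>F\<close> may exceed the support of \<open>f\<close>; in a sum of
    two elements components can cancel on the union of the supports.\<close>
  have c_eq: "c x g = f g"
    if f: "\<And>g. g \<in> carrier G \<Longrightarrow> f g \<in> Sg g" and F: "finite F" "F \<subseteq> carrier G"
      and zero: "\<And>g. g \<in> carrier G \<Longrightarrow> g \<notin> F \<Longrightarrow> f g = \<zero>\<^bsub>S\<^esub>"
      and x: "x = finsum S f F" and g: "g \<in> carrier G" for x f F g
  proof -
    let ?f = "restrict f (carrier G)" and ?supp = "{g\<in>carrier G. f g \<noteq> \<zero>\<^bsub>S\<^esub>}"
    have supp: "?supp \<subseteq> F" using zero by auto
    have "finsum S f F = finsum S ?f ?supp"
      using F supp f car by (intro add.finprod_mono_neutral_cong_right) auto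
    moreover have "{g\<in>carrier G. ?f g \<noteq> \<zero>\<^bsub>S\<^esub>} = ?supp" by auto
    ultimately have "decomposition S G Sg x ?f"
      using f finite_subset[OF supp F(1)] x by (simp add: decomposition_def)
    moreover have "x \<in> carrier S"
      using x F f car by (auto intro!: finsum_closed)
    ultimately have "c x = ?f"
      using ex1 c by blast
    then show ?thesis using g by simp
  qed
  have sum: "finite F \<Longrightarrow> F \<subseteq> carrier G \<Longrightarrow> {g\<in>carrier G. c x g \<noteq> \<zero>\<^bsub>S\<^esub>} \<subseteq> F \<Longrightarrow> x = finsum S (c x) F"
    if "x \<in> carrier S" for x F
  proof -
    assume F: "finite F" "F \<subseteq> carrier G" "{g\<in>carrier G. c x g \<noteq> \<zero>\<^bsub>S\<^esub>} \<subseteq> F"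
    have "finsum S (c x) F = finsum S (c x) {g\<in>carrier G. c x g \<noteq> \<zero>\<^bsub>S\<^esub>}"
      using F c[OF that] car by (intro add.finprod_mono_neutral_cong_right) (auto simp: decomposition_def)
    then show "x = finsum S (c x) F" using c[OF that] by (simp add: decomposition_def)
  qed
  have "graded_components S G Sg c"
  proof (rule graded_components.intro[OF ring_axioms G.group_axioms], rule graded_components_axioms.intro)
    show "additive_subgroup (Sg g) S" if "g \<in> carrier G" for g by (rule sub[OF that])
    show "x \<otimes>\<^bsub>S\<^esub> y \<in> Sg (g \<otimes>\<^bsub>G\<^esub> h)"
      if "g \<in> carrier G" "h \<in> carrier G" "x \<in> Sg g" "y \<in> Sg h" for g h x y
      using assms that by (simp add: graded_ring_def)
    show "c x g \<in> Sg g" if "x \<in> carrier S" "g \<in> carrier G" for x g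
      using c that by (simp add: decomposition_def)
    show "finite {g \<in> carrier G. c x g \<noteq> \<zero>\<^bsub>S\<^esub>}" if "x \<in> carrier S" for x
      using c that by (simp add: decomposition_def)
    show "c x h = (if h = g then x else \<zero>\<^bsub>S\<^esub>)"
      if g: "g \<in> carrier G" and h: "h \<in> carrier G" and x: "x \<in> Sg g" for g h x
    proof (rule c_eq[of "\<lambda>h. if h = g then x else \<zero>\<^bsub>S\<^esub>" "{g}"])
      show "x = finsum S (\<lambda>h. if h = g then x else \<zero>\<^bsub>S\<^esub>) {g}"
        using car[OF g x] by (simp add: finsum_insert[of "{}"])
    qed (use g h x additive_subgroup.zero_closed[OF sub] in auto)
    show "c (x \<oplus>\<^bsub>S\<^esub> y) g = c x g \<oplus>\<^bsub>S\<^esub> c y g"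
      if x: "x \<in> carrier S" and y: "y \<in> carrier S" and g: "g \<in> carrier G" for x y g
    proof -
      let ?F = "{g\<in>carrier G. c x g \<noteq> \<zero>\<^bsub>S\<^esub>} \<union> {g\<in>carrier G. c y g \<noteq> \<zero>\<^bsub>S\<^esub>}"
      have fin: "finite ?F" using c[OF x] c[OF y] by (simp add: decomposition_def)
      have cx: "c x g \<in> Sg g" "c y g \<in> Sg g" if "g \<in> carrier G" for g
        using that c[OF x] c[OF y] by (auto simp: decomposition_def)
      show ?thesis
      proof (rule c_eq[of "\<lambda>g. c x g \<oplus>\<^bsub>S\<^esub> c y g" ?F])
        show "x \<oplus>\<^bsub>S\<^esub> y = finsum S (\<lambda>g. c x g \<oplus>\<^bsub>S\<^esub> c y g) ?F"
        proof -
          have "c x \<in> ?F \<rightarrow> carrier S" "c y \<in> ?F \<rightarrow> carrier S"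
            using cx car by auto
          moreover have "x = finsum S (c x) ?F" "y = finsum S (c y) ?F"
            using sum[OF x fin] sum[OF y fin] by auto
          ultimately show ?thesis
            using finsum_addf[of "c x" ?F "c y"] by simp
        qed
      qed (use cx g fin additive_subgroup.a_closed[OF sub] in auto)
    qed
    show "x = y" if x: "x \<in> carrier S" and y: "y \<in> carrier S"
      and eq: "\<And>g. g \<in> carrier G \<Longrightarrow> c x g = c y g" for x y
    proof -
      have "c x = c y"
        using c[OF x] c[OF y] eq by (auto simp: decomposition_def intro: extensionalityI)
      then show ?thesis
        using c[OF x] c[OF y] by (simp add: decomposition_def)
    qed
  qed
  then show ?thesis by (simp add: c_def)
qed

section \<open>The opposite ring\<close>

definition opposite_ring :: "('a, 'b) ring_scheme \<Rightarrow> ('a, 'b) ring_scheme" where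
  "opposite_ring S = S\<lparr>mult := \<lambda>x y. y \<otimes>\<^bsub>S\<^esub> x\<rparr>"

lemma opposite_ring_simps [simp]:
  "carrier (opposite_ring S) = carrier S" "\<one>\<^bsub>opposite_ring S\<^esub> = \<one>\<^bsub>S\<^esub>"
  "\<zero>\<^bsub>opposite_ring S\<^esub> = \<zero>\<^bsub>S\<^esub>" "add (opposite_ring S) = add S"
  "x \<otimes>\<^bsub>opposite_ring S\<^esub> y = y \<otimes>\<^bsub>S\<^esub> x" "finsum (opposite_ring S) f A = finsum S f A"
  by (simp_all add: opposite_ring_def finsum_def)

lemma set_prod_opposite: "set_prod (opposite_ring S) A B = set_prod S B A"
  unfolding set_prod_def by (simp, blast)

lemma left_ideal_opposite: "left_ideal I (opposite_ring S) \<longleftrightarrow> right_ideal I S"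
  by (simp add: left_ideal_def right_ideal_def additive_subgroup_def)

lemma left_noetherian_opposite: "left_noetherian (opposite_ring S) \<longleftrightarrow> right_noetherian S"
  by (simp add: left_noetherian_def right_noetherian_def left_ideal_opposite)

lemma ring_opposite:
  assumes "ring S"
  shows "ring (opposite_ring S)"
proof -
  interpret ring S by (rule assms)
  show ?thesis
  proof (rule ringI)
    show "abelian_group (opposite_ring S)"
      using abelian_group_axioms by (simp add: abelian_group_def abelian_group_axioms_def abelian_monoid_def)
    show "Group.monoid (opposite_ring S)"
      by (rule monoidI) (simp_all add: m_assoc)
  qed (simp_all add: l_distr r_distr)
qed

text \<open>Reversing products would reverse degrees; inverting the degrees restores their order, so
  the grading group remains \<open>G\<close> and the assumption on \<open>G\<close> applies
  again.\<close>

lemma (in graded_components) graded_components_opposite: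
  "graded_components (opposite_ring S) G (\<lambda>g. Sg (inv\<^bsub>G\<^esub> g)) (\<lambda>x g. cmp x (inv\<^bsub>G\<^esub> g))"
proof -
  interpret op: ring "opposite_ring S" by (rule ring_opposite[OF ring_axioms])
  show ?thesis
  proof (rule graded_components.intro[OF op.ring_axioms G.group_axioms], rule graded_components_axioms.intro)
    show "additive_subgroup (Sg (inv\<^bsub>G\<^esub> g)) (opposite_ring S)" if "g \<in> carrier G" for g
      using Sg_subgroup[of "inv\<^bsub>G\<^esub> g"] that by (simp add: additive_subgroup_def)
    show "x \<otimes>\<^bsub>opposite_ring S\<^esub> y \<in> Sg (inv\<^bsub>G\<^esub> (g \<otimes>\<^bsub>G\<^esub> h))"
      if "g \<in> carrier G" "h \<in> carrier G" "x \<in> Sg (inv\<^bsub>G\<^esub> g)" "y \<in> Sg (inv\<^bsub>G\<^esub> h)" for g h x y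
      using that Sg_mult[of "inv\<^bsub>G\<^esub> h" "inv\<^bsub>G\<^esub> g" y x] by (simp add: G.inv_mult_group)
    show "finite {g \<in> carrier G. cmp x (inv\<^bsub>G\<^esub> g) \<noteq> \<zero>\<^bsub>opposite_ring S\<^esub>}"
      if "x \<in> carrier (opposite_ring S)" for x
    proof (rule finite_subset)
      show "{g \<in> carrier G. cmp x (inv\<^bsub>G\<^esub> g) \<noteq> \<zero>\<^bsub>opposite_ring S\<^esub>}
          \<subseteq> (\<lambda>g. inv\<^bsub>G\<^esub> g) ` {g \<in> carrier G. cmp x g \<noteq> \<zero>}"
      proof
        fix g assume "g \<in> {g \<in> carrier G. cmp x (inv\<^bsub>G\<^esub> g) \<noteq> \<zero>\<^bsub>opposite_ring S\<^esub>}"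
        then show "g \<in> (\<lambda>g. inv\<^bsub>G\<^esub> g) ` {g \<in> carrier G. cmp x g \<noteq> \<zero>}"
          by (intro image_eqI[of _ _ "inv\<^bsub>G\<^esub> g"]) auto
      qed
      show "finite ((\<lambda>g. inv\<^bsub>G\<^esub> g) ` {g \<in> carrier G. cmp x g \<noteq> \<zero>})"
        using finite_support that by simp
    qed
    show "x = y" if "x \<in> carrier (opposite_ring S)" "y \<in> carrier (opposite_ring S)"
      and eq: "\<And>g. g \<in> carrier G \<Longrightarrow> cmp x (inv\<^bsub>G\<^esub> g) = cmp y (inv\<^bsub>G\<^esub> g)" for x y
    proof (rule cmp_eqI)
      show "cmp x g = cmp y g" if "g \<in> carrier G" for g
        using eq[of "inv\<^bsub>G\<^esub> g"] that by simp
    qed (use that in auto)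
    show "cmp x (inv\<^bsub>G\<^esub> h) = (if h = g then x else \<zero>\<^bsub>opposite_ring S\<^esub>)"
      if "g \<in> carrier G" "h \<in> carrier G" "x \<in> Sg (inv\<^bsub>G\<^esub> g)" for g h x
      using that inj_on_eq_iff[OF G.inv_inj, of h g] by (simp add: cmp_homogeneous[of "inv\<^bsub>G\<^esub> g"])
  qed (simp_all add: cmp_in cmp_add)
qed

text \<open>The identity of S_g S_{g^-1} acts on the left of S_g = (S_g S_{g^-1}) S_g and on the
  right of S_{g^-1} = S_{g^-1} (S_g S_{g^-1}). The second half serves the opposite ring, whose
  component of degree g is S_{g^-1}.\<close>

lemma epsilon_strongly_graded_units:
  assumes eps: "epsilon_strongly_graded S G Sg" and g: "g \<in> carrier G"
  shows "\<exists>\<epsilon>\<in>set_prod S (Sg g) (Sg (inv\<^bsub>G\<^esub> g)).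
           (\<forall>x\<in>Sg g. \<epsilon> \<otimes>\<^bsub>S\<^esub> x = x) \<and> (\<forall>x\<in>Sg (inv\<^bsub>G\<^esub> g). x \<otimes>\<^bsub>S\<^esub> \<epsilon> = x)"
proof -
  have gr: "graded_ring S G Sg" using eps by (simp add: epsilon_strongly_graded_def)
  interpret graded_components S G Sg "\<lambda>x. THE f. decomposition S G Sg x f"
    by (rule graded_ring_components[OF gr])
  have ic: "inv\<^bsub>G\<^esub> g \<in> carrier G" using g by simp
  let ?P = "\<lambda>g. set_prod S (Sg g) (Sg (inv\<^bsub>G\<^esub> g))"
  have triple: "set_prod S (?P h) (Sg h) = Sg h" if "h \<in> carrier G" for h
    using eps that by (simp add: epsilon_strongly_graded_def)
  obtain \<epsilon> where \<epsilon>: "\<epsilon> \<in> ?P g" "\<And>x. x \<in> ?P g \<Longrightarrow> \<epsilon> \<otimes>\<^bsub>S\<^esub> x = x \<and> x \<otimes>\<^bsub>S\<^esub> \<epsilon> = x"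
    using eps g unfolding epsilon_strongly_graded_def by blast
  have sub: "Sg h \<subseteq> carrier S" if "h \<in> carrier G" for h
    using Sg_carrier that by blast
  have Pc: "?P h \<subseteq> carrier S" if "h \<in> carrier G" for h
  proof
    fix x assume "x \<in> ?P h"
    then show "x \<in> carrier S"
      using sub[OF that] sub[OF G.inv_closed[OF that]]
      by (induction x rule: set_prod_induct) (use that Sg_carrier[OF G.inv_closed[OF that]] in simp_all)
  qed
  have \<epsilon>c: "\<epsilon> \<in> carrier S" using \<epsilon>(1) Pc[OF g] by blast
  have prod: "a \<otimes>\<^bsub>S\<^esub> b \<in> ?P g" if "a \<in> Sg g" "b \<in> Sg (inv\<^bsub>G\<^esub> g)" for a b
  proof -
    have "a \<otimes>\<^bsub>S\<^esub> b \<in> carrier S" using that sub[OF g] sub[OF ic] by blast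
    then have "a \<otimes>\<^bsub>S\<^esub> b = finsum S (\<lambda>i. a \<otimes>\<^bsub>S\<^esub> b) {..<1::nat}"
      by (simp add: lessThan_Suc finsum_insert[of "{}"])
    then show ?thesis
      unfolding set_prod_def using that
      by (intro CollectI exI[of _ 1] exI[of _ "\<lambda>_. a"] exI[of _ "\<lambda>_. b"]) blast
  qed
  have left: "\<epsilon> \<otimes>\<^bsub>S\<^esub> x = x" if "x \<in> Sg g" for x
  proof -
    have "x \<in> set_prod S (?P g) (Sg g)" using triple[OF g] that by simp
    then show ?thesis
      using Pc[OF g] sub[OF g]
    proof (induction x rule: set_prod_induct)
      case (mult a b)
      moreover have "a \<in> carrier S" "b \<in> carrier S"
        using mult Pc[OF g] sub[OF g] by auto
      ultimately show ?case using \<epsilon>(2)[of a] \<epsilon>c by (simp flip: m_assoc)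
    qed (use \<epsilon>c in \<open>simp_all add: r_distr\<close>)
  qed
  \<comment> \<open>The triple product is bracketed to the left, so for a = uv one regroups (uv)b as
    u(vb), where vb lies in S_g S_{g^-1}.\<close>
  have assoc_right: "a \<otimes>\<^bsub>S\<^esub> b \<otimes>\<^bsub>S\<^esub> \<epsilon> = a \<otimes>\<^bsub>S\<^esub> b"
    if "a \<in> ?P (inv\<^bsub>G\<^esub> g)" and b: "b \<in> Sg (inv\<^bsub>G\<^esub> g)" for a b
  proof -
    have bc: "b \<in> carrier S" using b sub[OF ic] by blast
    have "a \<in> set_prod S (Sg (inv\<^bsub>G\<^esub> g)) (Sg g)" using that g by simp
    then have "a \<in> carrier S \<and> a \<otimes>\<^bsub>S\<^esub> b \<otimes>\<^bsub>S\<^esub> \<epsilon> = a \<otimes>\<^bsub>S\<^esub> b"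
      using sub[OF ic] sub[OF g]
    proof (induction a rule: set_prod_induct)
      case (mult u v)
      moreover have "u \<in> carrier S" "v \<in> carrier S"
        using mult sub[OF ic] sub[OF g] by auto
      ultimately show ?case
        using \<epsilon>(2)[OF prod[OF mult(2) b]] \<epsilon>c bc by (simp add: m_assoc)
    qed (use \<epsilon>c bc in \<open>simp_all add: l_distr\<close>)
    then show ?thesis by blast
  qed
  have right: "x \<otimes>\<^bsub>S\<^esub> \<epsilon> = x" if "x \<in> Sg (inv\<^bsub>G\<^esub> g)" for x
  proof -
    have "x \<in> set_prod S (?P (inv\<^bsub>G\<^esub> g)) (Sg (inv\<^bsub>G\<^esub> g))" using triple[OF ic] that by simp
    then show ?thesis
      using Pc[OF ic] sub[OF ic]
      by (induction x rule: set_prod_induct) (use \<epsilon>c in \<open>simp_all add: l_distr assoc_right\<close>)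
  qed
  show ?thesis using \<epsilon>(1) left right by blast
qed

theorem theorem1p1:
  fixes S :: "('a, 'b) ring_scheme" and G :: "('g, 'c) monoid_scheme"
    and Sg :: "'g \<Rightarrow> 'a set"
  assumes "polycyclic_by_finite G"
    and "epsilon_strongly_graded S G Sg"
  shows "(left_noetherian S \<longleftrightarrow> left_noetherian (S\<lparr>carrier := Sg \<one>\<^bsub>G\<^esub>\<rparr>)) \<and>
         (right_noetherian S \<longleftrightarrow> right_noetherian (S\<lparr>carrier := Sg \<one>\<^bsub>G\<^esub>\<rparr>))"
proof
  note units = epsilon_strongly_graded_units[OF assms(2)]
  have "graded_ring S G Sg" using assms(2) by (simp add: epsilon_strongly_graded_def)
  then interpret graded_components S G Sg "\<lambda>x. THE f. decomposition S G Sg x f"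
    by (rule graded_ring_components)
  interpret op: graded_components "opposite_ring S" G "\<lambda>g. Sg (inv\<^bsub>G\<^esub> g)"
    "\<lambda>x g. (THE f. decomposition S G Sg x f) (inv\<^bsub>G\<^esub> g)"
    by (rule graded_components_opposite)
  show "left_noetherian S \<longleftrightarrow> left_noetherian (S\<lparr>carrier := Sg \<one>\<^bsub>G\<^esub>\<rparr>)"
    by (rule left_noetherian_iff_principal[OF assms(1)]) (use units in blast)
  have "left_noetherian (opposite_ring S) \<longleftrightarrow>
      left_noetherian ((opposite_ring S)\<lparr>carrier := Sg (inv\<^bsub>G\<^esub> \<one>\<^bsub>G\<^esub>)\<rparr>)"
  proof (rule op.left_noetherian_iff_principal[OF assms(1)])
    \<comment> \<open>In the opposite ring the components of degrees g and g^-1 again multiply to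
      S_g S_{g^-1}, and the right identity on S_{g^-1} becomes a left one.\<close>
    fix g assume g: "g \<in> carrier G"
    then show "\<exists>\<epsilon>\<in>set_prod (opposite_ring S) (Sg (inv\<^bsub>G\<^esub> g)) (Sg (inv\<^bsub>G\<^esub> (inv\<^bsub>G\<^esub> g))).
        \<forall>x\<in>Sg (inv\<^bsub>G\<^esub> g). \<epsilon> \<otimes>\<^bsub>opposite_ring S\<^esub> x = x"
      using units[OF g] by (auto simp: set_prod_opposite)
  qed
  moreover have "(opposite_ring S)\<lparr>carrier := Sg (inv\<^bsub>G\<^esub> \<one>\<^bsub>G\<^esub>)\<rparr> = opposite_ring (S\<lparr>carrier := Sg \<one>\<^bsub>G\<^esub>\<rparr>)"
    by (simp add: opposite_ring_def)
  ultimately show "right_noetherian S \<longleftrightarrow> right_noetherian (S\<lparr>carrier := Sg \<one>\<^bsub>G\<^esub>\<rparr>)"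
    by (simp add: left_noetherian_opposite)
qed

end
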